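(* Any CONGEST algorithm (possibly randomized, succeeding with probability at least $2/3$) that, given a directed weighted $n$-vertex graph $G$, vertices $s,t$ and a shortest $s$-$t$ path $P_{st}$, solves the Replacement Paths problem, or the Second Simple Shortest Path problem, for $P_{st}$ requires $\Omega\!\left(\frac{n}{\log n}\right)$ rounds in the worst case; this holds even when restricted to input graphs whose undirected diameter is a constant.
   Context: CONGEST model: the communication network is the graph $G=(V,E)$, $n=|V|$; each node has a unique identifier in $\{0,\dots,n-1\}$, knows its own and its neighbours' identifiers and the weights of its incident edges (weights are integers in $\{0,1,\dots,W\}$ with $W=\mathrm{poly}(n)$); computation proceeds in synchronous rounds in which each node may send a message of $O(\log n)$ bits to each neighbour; local computation is free; communication links are bidirectional and unweighted even when $G$ is directed. Complexity is the number of rounds. The undirected diameter $D$ is the diameter of the underlying undirected unweighted graph of $G$. Replacement Paths (RPaths): given $G$, $s,t$, and a shortest $s$-$t$ path $P_{st}$, for each edge $e\in P_{st}$ some vertex must compute the weight of a shortest simple $s$-$t$ path $P_e$ avoiding $e$, and every vertex on $P_e$ must know its successor on $P_e$. Second Simple Shortest Path (2-SiSP): some vertex must compute the weight of a minimum-weight simple $s$-$t$ path not containing at least one edge of $P_{st}$, and each vertex on such a path must know its successor on it. *)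

theory Defs
  imports "HOL-Probability.Probability_Mass_Function" "HOL-Library.Extended_Nat"
begin

record inst =
  nv  :: nat                    \<comment> \<open>number of nodes; identifiers are 0..nv-1\<close>
  E   :: "(nat \<times> nat) set"
  wt  :: "nat \<times> nat \<Rightarrow> nat"     \<comment> \<open>edge weights (meaningful on E)\<close>
  src :: nat
  tgt :: nat
  P   :: "nat list"             \<comment> \<open>the given shortest s-t path, as a vertex list\<close>

definition path_edges :: "nat list \<Rightarrow> (nat \<times> nat) set" where
  "path_edges p = set (zip p (tl p))"

definition path_weight :: "inst \<Rightarrow> nat list \<Rightarrow> nat" where
  "path_weight I p = sum_list (map (wt I) (zip p (tl p)))"

definition is_path :: "inst \<Rightarrow> nat list \<Rightarrow> bool" where
  "is_path I p \<longleftrightarrow> p \<noteq> [] \<and> set p \<subseteq> {..<nv I} \<and> path_edges p \<subseteq> E I"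

definition st_path :: "inst \<Rightarrow> nat list \<Rightarrow> bool" where
  "st_path I p \<longleftrightarrow> is_path I p \<and> hd p = src I \<and> last p = tgt I"

definition simple_st_path :: "inst \<Rightarrow> nat list \<Rightarrow> bool" where
  "simple_st_path I p \<longleftrightarrow> st_path I p \<and> distinct p"

definition shortest_st_path :: "inst \<Rightarrow> nat list \<Rightarrow> bool" where
  "shortest_st_path I p \<longleftrightarrow> simple_st_path I p \<and>
     (\<forall>q. st_path I q \<longrightarrow> path_weight I p \<le> path_weight I q)"

definition adj :: "inst \<Rightarrow> nat \<Rightarrow> nat \<Rightarrow> bool" where
  "adj I u v \<longleftrightarrow> (u, v) \<in> E I \<or> (v, u) \<in> E I"

definition upath :: "inst \<Rightarrow> nat list \<Rightarrow> bool" where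
  "upath I p \<longleftrightarrow> p \<noteq> [] \<and> set p \<subseteq> {..<nv I} \<and> (\<forall>(a, b) \<in> set (zip p (tl p)). adj I a b)"

definition und_diam_le :: "inst \<Rightarrow> nat \<Rightarrow> bool" where
  "und_diam_le I D \<longleftrightarrow> (\<forall>u < nv I. \<forall>v < nv I.
     \<exists>p. upath I p \<and> hd p = u \<and> last p = v \<and> length p \<le> Suc D)"

definition valid_inst :: "nat \<Rightarrow> nat \<Rightarrow> nat \<Rightarrow> inst \<Rightarrow> bool" where
  "valid_inst n Wm D I \<longleftrightarrow> nv I = n \<and> E I \<subseteq> {..<n} \<times> {..<n} \<and> (\<forall>x. (x, x) \<notin> E I) \<and>
     (\<forall>e \<in> E I. wt I e \<le> Wm) \<and> src I < n \<and> tgt I < n \<and>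
     shortest_st_path I (P I) \<and> und_diam_le I D"

text \<open>Weight of a shortest simple s-t path avoiding edge e (infinity if none).\<close>
definition repl_weight :: "inst \<Rightarrow> nat \<times> nat \<Rightarrow> enat" where
  "repl_weight I e = Inf {enat (path_weight I p) | p. simple_st_path I p \<and> e \<notin> path_edges p}"

definition sisp_weight :: "inst \<Rightarrow> enat" where
  "sisp_weight I = Inf {enat (path_weight I p) | p. simple_st_path I p \<and>
                                                   \<not> path_edges (P I) \<subseteq> path_edges p}"

text \<open>RPaths output of a node: for each edge e, an optional claimed replacement
  weight, and an optional successor on the replacement path P_e.\<close>
type_synonym rp_out = "(nat \<times> nat \<Rightarrow> enat option) \<times> (nat \<times> nat \<Rightarrow> nat option)"

definition RP_correct :: "inst \<Rightarrow> (nat \<Rightarrow> rp_out) \<Rightarrow> bool" where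
  "RP_correct I Out \<longleftrightarrow> (\<forall>e \<in> path_edges (P I).
     (\<exists>v < nv I. fst (Out v) e \<noteq> None) \<and>
     (\<forall>v < nv I. fst (Out v) e \<noteq> None \<longrightarrow> fst (Out v) e = Some (repl_weight I e)) \<and>
     (repl_weight I e \<noteq> \<infinity> \<longrightarrow>
        (\<exists>p. simple_st_path I p \<and> e \<notin> path_edges p \<and> enat (path_weight I p) = repl_weight I e \<and>
             (\<forall>(a, b) \<in> path_edges p. snd (Out a) e = Some b))))"

text \<open>2-SiSP output of a node: optional claimed weight and optional successor.\<close>
type_synonym sisp_out = "enat option \<times> nat option"

definition SISP_correct :: "inst \<Rightarrow> (nat \<Rightarrow> sisp_out) \<Rightarrow> bool" where
  "SISP_correct I Out \<longleftrightarrow>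
     (\<exists>v < nv I. fst (Out v) \<noteq> None) \<and>
     (\<forall>v < nv I. fst (Out v) \<noteq> None \<longrightarrow> fst (Out v) = Some (sisp_weight I)) \<and>
     (sisp_weight I \<noteq> \<infinity> \<longrightarrow>
        (\<exists>p. simple_st_path I p \<and> \<not> path_edges (P I) \<subseteq> path_edges p \<and>
             enat (path_weight I p) = sisp_weight I \<and>
             (\<forall>(a, b) \<in> path_edges p. snd (Out a) = Some b)))"

text \<open>Local input of a node: n, its identifier, s and t, weights of its incident
  out- and in-edges (which also reveals its neighbours' identifiers), and its local
  knowledge of P_st (its position on P_st and its successor on P_st, if any).\<close>
record linput =
  li_n     :: nat
  li_id    :: nat
  li_s     :: nat
  li_t     :: nat
  li_out   :: "nat \<Rightarrow> nat option"
  li_in    :: "nat \<Rightarrow> nat option"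
  li_ppos  :: "nat option"
  li_psucc :: "nat option"

definition local_input :: "inst \<Rightarrow> nat \<Rightarrow> linput" where
  "local_input I v = \<lparr> li_n = nv I, li_id = v, li_s = src I, li_t = tgt I,
     li_out = (\<lambda>u. if (v, u) \<in> E I then Some (wt I (v, u)) else None),
     li_in = (\<lambda>u. if (u, v) \<in> E I then Some (wt I (u, v)) else None),
     li_ppos = (if v \<in> set (P I) then Some (LEAST i. P I ! i = v) else None),
     li_psucc = (if \<exists>u. (v, u) \<in> path_edges (P I)
                 then Some (THE u. (v, u) \<in> path_edges (P I)) else None) \<rparr>"

text \<open>A deterministic CONGEST algorithm in full-information form: a node's message to
  neighbour u in the next round, and its output, are arbitrary functions of its local
  input and its history (the list, per past round, of the bit strings received from
  each node). Local computation is free.\<close>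
record 'o dalg =
  msg :: "linput \<Rightarrow> (nat \<Rightarrow> bool list) list \<Rightarrow> nat \<Rightarrow> bool list"
  out :: "linput \<Rightarrow> (nat \<Rightarrow> bool list) list \<Rightarrow> 'o"

fun hist :: "'o dalg \<Rightarrow> inst \<Rightarrow> nat \<Rightarrow> nat \<Rightarrow> (nat \<Rightarrow> bool list) list" where
  "hist A I 0 v = []"
| "hist A I (Suc i) v = hist A I i v @
     [\<lambda>u. if adj I u v then msg A (local_input I u) (hist A I i u) v else []]"

definition run :: "'o dalg \<Rightarrow> inst \<Rightarrow> nat \<Rightarrow> nat \<Rightarrow> 'o" where
  "run A I T v = out A (local_input I v) (hist A I T v)"

text \<open>A randomized algorithm is a probability distribution over deterministic
  algorithms (public randomness). Bandwidth: every message has at most B bits.\<close>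
definition bandwidth_ok :: "'o dalg pmf \<Rightarrow> nat \<Rightarrow> bool" where
  "bandwidth_ok R B \<longleftrightarrow> (\<forall>A \<in> set_pmf R. \<forall>li h u. length (msg A li h u) \<le> B)"

definition solves :: "(inst \<Rightarrow> (nat \<Rightarrow> 'o) \<Rightarrow> bool) \<Rightarrow> 'o dalg pmf \<Rightarrow> nat \<Rightarrow> nat \<Rightarrow> nat \<Rightarrow> nat \<Rightarrow> bool" where
  "solves C R n Wm D T \<longleftrightarrow> (\<forall>I. valid_inst n Wm D I \<longrightarrow>
     measure_pmf.prob R {A. C I (run A I T)} \<ge> 2/3)"

definition clog :: "nat \<Rightarrow> nat" where
  "clog n = nat \<lceil>log 2 (real n)\<rceil>"

end

theory Submission
  imports Defs
begin

text \<open>The hard instances encode set disjointness on the \<open>m\<^sup>2\<close> pairs \<open>(i, j)\<close>, \<open>m = \<Theta>(n)\<close>: Alice's set \<open>x\<close>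
  and Bob's set \<open>y\<close> are edge sets on the two sides of a cut with \<open>O(m)\<close> links, and a detour around the
  \<open>k\<close>-th path edge has weight at most \<open>m\<close> iff some \<open>(k, j)\<close> lies in \<open>x \<inter> y\<close>. A \<open>T\<close>-round algorithm is thus
  a protocol with \<open>O(m T log n)\<close> bits, whereas disjointness needs \<open>\<Omega>(m\<^sup>2)\<close>.

  For the latter, pick a random set \<open>T\<close>, then \<open>x \<subseteq> T\<close> and \<open>y \<subseteq> U - T\<close> uniformly. Given \<open>T\<close>, the sets
  are independent, so a large rectangle is, by the level-one inequality for Boolean functions, almost
  insensitive to a typical coordinate of \<open>x\<close> or of \<open>y\<close>. Forcing a random common element therefore changes
  the mass of large rectangles only by a factor close to \<open>1\<close>, and small rectangles are negligible
  unless there are \<open>exp (\<Omega>(m\<^sup>2))\<close> of them.\<close>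

section \<open>A level-one inequality\<close>

text \<open>Weak form of \<open>cosh l <= exp (l^2 / 2)\<close>; giving up the factor 2 in the
  exponent makes quadratic bounds enough. For \<open>exp (- l)\<close>, pass through
  \<open>1 / (1 + l)\<close> and use \<open>(1 - l + l^2) * (1 + l) = 1 + l^3\<close>.\<close>

lemma exp_add_exp_minus_le:
  fixes l :: real
  assumes "0 \<le> l" "l \<le> 1"
  shows "exp l + exp (- l) \<le> 2 * exp (l\<^sup>2)"
proof -
  have 1: "exp l \<le> 1 + l + l\<^sup>2" using exp_bound assms by blast
  have "exp (- l) * (1 + l) \<le> 1"
    using exp_ge_add_one_self[of l] by (simp add: exp_minus field_simps)
  moreover have "1 \<le> (1 - l + l\<^sup>2) * (1 + l)"
    using assms by (simp add: algebra_simps power2_eq_square)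
  ultimately have "exp (- l) * (1 + l) \<le> (1 - l + l\<^sup>2) * (1 + l)" by linarith
  then have 2: "exp (- l) \<le> 1 - l + l\<^sup>2" using assms by (simp add: mult_le_cancel_right)
  show ?thesis using 1 2 exp_ge_add_one_self[of "l\<^sup>2"] by linarith
qed

text \<open>Coordinates as random signs, that is, the degree-one Fourier characters of the cube of
  subsets.\<close>

definition chi :: "'a \<Rightarrow> 'a set \<Rightarrow> real" where
  "chi i x = (if i \<in> x then 1 else - 1)"

text \<open>Moment generating function of a signed sum of independent random signs: the exponential
  is a product over coordinates, so the sum over the cube factorizes and each factor is bounded
  separately.\<close>

lemma sum_exp_signed_chi_le:
  fixes l :: real and s :: "'a \<Rightarrow> real"
  assumes fin: "finite T" and l: "0 \<le> l" "l \<le> 1" and s: "\<And>i. i \<in> T \<Longrightarrow> \<bar>s i\<bar> = 1"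
  shows "(\<Sum>x\<in>Pow T. exp (l * (\<Sum>i\<in>T. s i * chi i x))) \<le> 2 ^ card T * exp (l\<^sup>2 * card T)"
proof -
  have "exp (l * (\<Sum>i\<in>T. s i * chi i x))
      = (\<Prod>i\<in>x. exp (l * s i)) * (\<Prod>i\<in>T - x. exp (- (l * s i)))" if "x \<in> Pow T" for x
  proof -
    have "exp (l * (\<Sum>i\<in>T. s i * chi i x)) = (\<Prod>i\<in>T. exp (l * (s i * chi i x)))"
      using fin by (simp add: sum_distrib_left exp_sum)
    also have "\<dots> = (\<Prod>i\<in>T - x. exp (l * (s i * chi i x))) * (\<Prod>i\<in>x. exp (l * (s i * chi i x)))"
      using that fin by (intro prod.subset_diff) auto
    finally show ?thesis by (simp add: chi_def mult.commute)
  qed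
  then have "(\<Sum>x\<in>Pow T. exp (l * (\<Sum>i\<in>T. s i * chi i x)))
      = (\<Prod>i\<in>T. exp (l * s i) + exp (- (l * s i)))"
    using fin by (subst prod_add) auto
  also have "\<dots> \<le> (\<Prod>i\<in>T. 2 * exp (l\<^sup>2))"
  proof (rule prod_mono)
    fix i assume "i \<in> T"
    then have "s i = 1 \<or> s i = - 1" using s[of i] by linarith
    then show "0 \<le> exp (l * s i) + exp (- (l * s i)) \<and> exp (l * s i) + exp (- (l * s i)) \<le> 2 * exp (l\<^sup>2)"
      using exp_add_exp_minus_le[OF l] by (auto simp: add.commute intro: add_nonneg_nonneg)
  qed
  also have "\<dots> = 2 ^ card T * exp (l\<^sup>2 * card T)"
    by (simp add: power_mult_distrib exp_of_nat_mult[symmetric] mult.commute)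
  finally show ?thesis .
qed

text \<open>Chernoff tail beyond \<open>e * N\<close> with exponent parameter \<open>e / 2\<close>:
  the decay \<open>exp (- (e^2 * N / 2))\<close> against the moment bound
  \<open>exp (e^2 * N / 4)\<close>. The prefactor \<open>2 / e\<close> pays for bounding a linear
  excess by an exponential.\<close>

definition tail_err :: "real \<Rightarrow> nat \<Rightarrow> real" where
  "tail_err e N = 2 / e * exp (- (e\<^sup>2 * N / 4))"

lemma tail_err_nonneg: "0 < e \<Longrightarrow> 0 \<le> tail_err e N"
  by (simp add: tail_err_def)

text \<open>Taking the sign of each coefficient turns the left side into the correlation of
  \<open>f\<close> with a sum \<open>Z\<close> of random signs, and \<open>Z\<close> exceeds
  \<open>e * N\<close> only on an exponentially small part of the cube. \<open>N\<close> is separate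
  from \<open>card T\<close> so that one threshold serves all subsets of a universe.\<close>

lemma level_one_inequality:
  fixes f :: "'a set \<Rightarrow> real" and e :: real
  assumes fin: "finite T" and N: "card T \<le> N" and e: "0 < e" "e \<le> 1"
    and f: "\<And>x. 0 \<le> f x" "\<And>x. f x \<le> 1"
  shows "(\<Sum>i\<in>T. \<bar>\<Sum>x\<in>Pow T. f x * chi i x\<bar>)
    \<le> e * N * (\<Sum>x\<in>Pow T. f x) + 2 ^ card T * tail_err e N"
proof -
  define s where "s i = (if (\<Sum>x\<in>Pow T. f x * chi i x) < 0 then - 1 else 1 :: real)" for i
  define Z where "Z x = (\<Sum>i\<in>T. s i * chi i x)" for x
  have "(\<Sum>i\<in>T. \<bar>\<Sum>x\<in>Pow T. f x * chi i x\<bar>) = (\<Sum>i\<in>T. \<Sum>x\<in>Pow T. f x * (s i * chi i x))"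
    unfolding s_def by (auto intro!: sum.cong simp: sum_negf)
  also have "\<dots> = (\<Sum>x\<in>Pow T. f x * Z x)"
    unfolding Z_def by (subst sum.swap) (simp add: sum_distrib_left)
  \<comment> \<open>The excess of \<open>Z x\<close> over \<open>e * N\<close> is replaced by an
    exponential, whose sum over the cube is already bounded.\<close>
  also have "\<dots> \<le> (\<Sum>x\<in>Pow T. e * N * f x + 2 / e * exp (e / 2 * (Z x - e * N)))"
  proof (rule sum_mono)
    fix x
    define u where "u = Z x - e * N"
    have "e / 2 * u \<le> exp (e / 2 * u)" using exp_ge_add_one_self[of "e / 2 * u"] by linarith
    then have "u \<le> 2 / e * exp (e / 2 * u)" using e by (simp add: field_simps)
    moreover have "0 \<le> 2 / e * exp (e / 2 * u)" using e by simp
    moreover have "f x * u \<le> max 0 u"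
      using f[of x] by (cases "u \<ge> 0") (auto simp: mult_left_le_one_le mult_nonneg_nonpos)
    ultimately have "f x * u \<le> 2 / e * exp (e / 2 * u)" by linarith
    then show "f x * Z x \<le> e * N * f x + 2 / e * exp (e / 2 * (Z x - e * N))"
      unfolding u_def by (simp add: algebra_simps)
  qed
  also have "\<dots> = e * N * (\<Sum>x\<in>Pow T. f x)
      + 2 / e * exp (- (e\<^sup>2 * N / 2)) * (\<Sum>x\<in>Pow T. exp (e / 2 * Z x))"
    by (simp add: sum.distrib sum_distrib_left sum_divide_distrib mult_exp_exp algebra_simps power2_eq_square)
  also have "\<dots> \<le> e * N * (\<Sum>x\<in>Pow T. f x)
      + 2 / e * exp (- (e\<^sup>2 * N / 2)) * (2 ^ card T * exp (e\<^sup>2 * N / 4))"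
  proof -
    have "(\<Sum>x\<in>Pow T. exp (e / 2 * Z x)) \<le> 2 ^ card T * exp ((e / 2)\<^sup>2 * card T)"
      unfolding Z_def using e by (intro sum_exp_signed_chi_le fin) (auto simp: s_def)
    also have "\<dots> \<le> 2 ^ card T * exp (e\<^sup>2 * N / 4)"
      using N by (simp add: power_divide mult_left_mono)
    finally show ?thesis using e by (intro add_left_mono mult_left_mono) auto
  qed
  also have "\<dots> = e * N * (\<Sum>x\<in>Pow T. f x) + 2 ^ card T * tail_err e N"
    by (simp add: tail_err_def mult_exp_exp)
  finally show ?thesis .
qed

lemma sum_Pow_split:
  fixes F :: "'a set \<Rightarrow> real"
  assumes "finite U" "i \<in> U"
  shows "(\<Sum>T\<in>Pow U. F T) = (\<Sum>T\<in>Pow (U - {i}). F T) + (\<Sum>T\<in>Pow (U - {i}). F (insert i T))"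
proof -
  have "Pow U = Pow (U - {i}) \<union> insert i ` Pow (U - {i})"
    using Pow_insert[of i "U - {i}"] assms(2) by (simp add: insert_absorb)
  moreover have "inj_on (insert i) (Pow (U - {i}))"
    by (auto simp: inj_on_def)
  ultimately show ?thesis using assms(1)
    by (simp, subst sum.union_disjoint) (auto simp: sum.reindex)
qed

section \<open>Randomized set disjointness\<close>

text \<open>Unnormalised: the total masses are \<open>4 ^ card U\<close> and \<open>card U * 4 ^ (card U - 1)\<close>.\<close>

definition disj_mass :: "'a set \<Rightarrow> ('a set \<Rightarrow> 'a set \<Rightarrow> real) \<Rightarrow> real" where
  "disj_mass U F = (\<Sum>T\<in>Pow U. \<Sum>x\<in>Pow T. \<Sum>y\<in>Pow (U - T). F x y)"

definition isect_mass :: "'a set \<Rightarrow> ('a set \<Rightarrow> 'a set \<Rightarrow> real) \<Rightarrow> real" where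
  "isect_mass U F = (\<Sum>i\<in>U. \<Sum>T\<in>Pow (U - {i}). \<Sum>x\<in>Pow T. \<Sum>y\<in>Pow (U - {i} - T).
     F (insert i x) (insert i y))"

text \<open>Double counting of the pairs with \<open>i \<in> T\<close>, coded by \<open>T\<close>
  with or without \<open>i\<close>.\<close>

lemma sum_Pow_members:
  assumes "finite U"
  shows "(\<Sum>i\<in>U. \<Sum>T\<in>Pow (U - {i}). (F i (insert i T) :: real)) = (\<Sum>T\<in>Pow U. \<Sum>i\<in>T. F i T)"
proof -
  have "(\<Sum>i\<in>U. \<Sum>T\<in>Pow (U - {i}). F i (insert i T)) = (\<Sum>i\<in>U. \<Sum>T\<in>{T \<in> Pow U. i \<in> T}. F i T)"
  proof (rule sum.cong[OF refl])
    fix i assume i: "i \<in> U"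
    show "(\<Sum>T\<in>Pow (U - {i}). F i (insert i T)) = (\<Sum>T\<in>{T \<in> Pow U. i \<in> T}. F i T)"
      by (rule sum.reindex_bij_witness[of _ "\<lambda>T. T - {i}" "insert i"]) (use i in auto)
  qed
  also have "\<dots> = (\<Sum>T\<in>Pow U. \<Sum>i\<in>{i \<in> U. i \<in> T}. F i T)"
    using assms by (intro sum.swap_restrict) auto
  also have "\<dots> = (\<Sum>T\<in>Pow U. \<Sum>i\<in>T. F i T)"
    by (intro sum.cong) auto
  finally show ?thesis .
qed

text \<open>The difference is the level-one coefficient of \<open>f\<close> at \<open>i\<close> on
  the cube of \<open>insert i T\<close>, and the sets \<open>y\<close> range over the complement of
  \<open>insert i T\<close>. Recounting by that set allows the level-one inequality for each fixed
  set, with the sum of \<open>g\<close> as a weight.\<close>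

lemma first_order_defect_le:
  fixes f g :: "'a set \<Rightarrow> real" and e :: real
  assumes U: "finite U" and e: "0 < e" "e \<le> 1"
    and f: "\<And>x. 0 \<le> f x" "\<And>x. f x \<le> 1" and g: "\<And>x. 0 \<le> g x" "\<And>x. g x \<le> 1"
  shows "(\<Sum>i\<in>U. \<Sum>T\<in>Pow (U - {i}).
       \<bar>(\<Sum>x\<in>Pow T. f (insert i x)) - (\<Sum>x\<in>Pow T. f x)\<bar> * (\<Sum>y\<in>Pow (U - {i} - T). g y))
    \<le> e * card U * disj_mass U (\<lambda>x y. f x * g y) + 4 ^ card U * tail_err e (card U)"
proof -
  have fT: "finite T" if "T \<in> Pow U" for T using that U finite_subset by auto
  define G where "G T = (\<Sum>y\<in>Pow (U - T). g y)" for T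
  have "(\<Sum>i\<in>U. \<Sum>T\<in>Pow (U - {i}).
       \<bar>(\<Sum>x\<in>Pow T. f (insert i x)) - (\<Sum>x\<in>Pow T. f x)\<bar> * (\<Sum>y\<in>Pow (U - {i} - T). g y))
     = (\<Sum>i\<in>U. \<Sum>T\<in>Pow (U - {i}). \<bar>\<Sum>x\<in>Pow (insert i T). f x * chi i x\<bar> * G (insert i T))"
  proof (intro sum.cong refl)
    fix i T assume i: "i \<in> U" and T: "T \<in> Pow (U - {i})"
    have T': "finite (insert i T)" "insert i T - {i} = T" using fT[of T] T by auto
    have "(\<Sum>x\<in>Pow (insert i T). f x * chi i x)
        = (\<Sum>x\<in>Pow T. f x * chi i x) + (\<Sum>x\<in>Pow T. f (insert i x) * chi i (insert i x))"
      using sum_Pow_split[OF T'(1), of i] T'(2) by simp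
    moreover have "(\<Sum>x\<in>Pow T. f x * chi i x) = - (\<Sum>x\<in>Pow T. f x)"
      unfolding sum_negf[symmetric] using T by (intro sum.cong) (auto simp: chi_def)
    ultimately have "(\<Sum>x\<in>Pow (insert i T). f x * chi i x)
        = (\<Sum>x\<in>Pow T. f (insert i x)) - (\<Sum>x\<in>Pow T. f x)"
      by (simp add: chi_def)
    moreover have "U - {i} - T = U - insert i T" by auto
    ultimately show "\<bar>(\<Sum>x\<in>Pow T. f (insert i x)) - (\<Sum>x\<in>Pow T. f x)\<bar> * (\<Sum>y\<in>Pow (U - {i} - T). g y)
      = \<bar>\<Sum>x\<in>Pow (insert i T). f x * chi i x\<bar> * G (insert i T)"
      by (simp add: G_def)
  qed
  also have "\<dots> = (\<Sum>T\<in>Pow U. \<Sum>i\<in>T. \<bar>\<Sum>x\<in>Pow T. f x * chi i x\<bar> * G T)"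
    by (rule sum_Pow_members[OF U])
  also have "\<dots> = (\<Sum>T\<in>Pow U. (\<Sum>i\<in>T. \<bar>\<Sum>x\<in>Pow T. f x * chi i x\<bar>) * G T)"
    by (simp add: sum_distrib_right)
  also have "\<dots> \<le> (\<Sum>T\<in>Pow U. e * card U * ((\<Sum>x\<in>Pow T. f x) * G T) + 2 ^ card U * tail_err e (card U))"
  proof (rule sum_mono)
    fix T assume T: "T \<in> Pow U"
    have G: "0 \<le> G T" unfolding G_def using g by (intro sum_nonneg) auto
    \<comment> \<open>The additive error has to be uniform in \<open>T\<close>: the factors
      \<open>2 ^ card T\<close> and \<open>2 ^ card (U - T)\<close> combine, and the sum over
      \<open>T\<close> supplies another \<open>2 ^ card U\<close>.\<close>
    have "G T \<le> real (card (Pow (U - T)))"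
      unfolding G_def using sum_bounded_above[of "Pow (U - T)" g 1] g by simp
    also have "\<dots> = 2 ^ card (U - T)" using U by (simp add: card_Pow)
    finally have "2 ^ card T * G T \<le> 2 ^ card T * 2 ^ card (U - T)" by simp
    also have "\<dots> = 2 ^ card U"
      using T U by (simp add: power_add[symmetric] card_Diff_subset fT card_mono)
    finally have G2: "2 ^ card T * G T \<le> 2 ^ card U" .
    have "(\<Sum>i\<in>T. \<bar>\<Sum>x\<in>Pow T. f x * chi i x\<bar>) * G T
        \<le> (e * card U * (\<Sum>x\<in>Pow T. f x) + 2 ^ card T * tail_err e (card U)) * G T"
      using T U by (intro mult_right_mono[OF level_one_inequality G] fT e f) (auto intro: card_mono)
    also have "\<dots> = e * card U * ((\<Sum>x\<in>Pow T. f x) * G T) + (2 ^ card T * G T) * tail_err e (card U)"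
      by (simp add: algebra_simps)
    also have "\<dots> \<le> e * card U * ((\<Sum>x\<in>Pow T. f x) * G T) + 2 ^ card U * tail_err e (card U)"
      using G2 tail_err_nonneg[OF e(1)] by (intro add_left_mono mult_right_mono) auto
    finally show "(\<Sum>i\<in>T. \<bar>\<Sum>x\<in>Pow T. f x * chi i x\<bar>) * G T \<le> \<dots>" .
  qed
  also have "\<dots> = e * card U * disj_mass U (\<lambda>x y. f x * g y) + 4 ^ card U * tail_err e (card U)"
  proof -
    have "disj_mass U (\<lambda>x y. f x * g y) = (\<Sum>T\<in>Pow U. (\<Sum>x\<in>Pow T. f x) * G T)"
      unfolding disj_mass_def G_def by (simp add: sum_product)
    moreover have "real (card (Pow U)) * 2 ^ card U = 4 ^ card U"
      using U by (simp add: card_Pow power_mult_distrib[symmetric])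
    ultimately show ?thesis by (simp add: sum.distrib sum_distrib_left)
  qed
  finally show ?thesis .
qed

text \<open>Complementing \<open>T\<close> exchanges the players, so a defect bound for Alice's set
  also serves for Bob's.\<close>

lemma disj_mass_swap:
  "disj_mass U F = disj_mass U (\<lambda>x y. F y x)"
proof -
  have "disj_mass U F = (\<Sum>T\<in>Pow U. \<Sum>x\<in>Pow (U - T). \<Sum>y\<in>Pow T. F x y)"
    unfolding disj_mass_def
    by (rule sum.reindex_bij_witness[of _ "\<lambda>T. U - T" "\<lambda>T. U - T"])
       (auto simp: double_diff)
  also have "\<dots> = disj_mass U (\<lambda>x y. F y x)"
    unfolding disj_mass_def by (intro sum.cong refl sum.swap)
  finally show ?thesis .
qed

text \<open>A first-order expansion without second-order loss: if both factors move the same way,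
  the cross term \<open>(p' - p) * (q' - q)\<close> is nonnegative; otherwise the larger new factor
  may be lowered to its old value.\<close>

lemma mult_ge_perturbation:
  fixes p p' q q' :: real
  assumes "0 \<le> p" "0 \<le> q" "0 \<le> p'" "0 \<le> q'"
  shows "p' * q' \<ge> p * q - \<bar>p' - p\<bar> * q - p * \<bar>q' - q\<bar>"
proof -
  consider "p \<le> p'" "q \<le> q'" | "p \<le> p'" "q' \<le> q" | "p' \<le> p" "q \<le> q'" | "p' \<le> p" "q' \<le> q"
    by linarith
  then show ?thesis
  proof cases
    case 1
    then have "p * q \<le> p' * q'" using assms by (intro mult_mono) auto
    moreover have "0 \<le> \<bar>p' - p\<bar> * q" "0 \<le> p * \<bar>q' - q\<bar>" using assms by auto
    ultimately show ?thesis by linarith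
  next
    case 2
    then have "p * q' \<le> p' * q'" "0 \<le> \<bar>p' - p\<bar> * q" using assms by (auto intro: mult_right_mono)
    moreover have "p * \<bar>q' - q\<bar> = p * q - p * q'" using 2 by (simp add: algebra_simps)
    ultimately show ?thesis by linarith
  next
    case 3
    then have "p' * q \<le> p' * q'" "0 \<le> p * \<bar>q' - q\<bar>" using assms by (auto intro: mult_left_mono)
    moreover have "\<bar>p' - p\<bar> * q = p * q - p' * q" using 3 by (simp add: algebra_simps)
    ultimately show ?thesis by linarith
  next
    case 4
    then have "0 \<le> (p - p') * (q - q')" by simp
    then show ?thesis using 4 by (simp add: algebra_simps)
  qed
qed

text \<open>Index 0 stands for \<open>i\<close> left out and index 1 for \<open>i\<close> put in.
  For each \<open>i\<close>, the disjoint mass sums \<open>p0 * (q0 + q1) + (p0 + p1) * q0\<close>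
  and the intersecting mass sums \<open>p1 * q1\<close>. Up to first-order defects these are
  \<open>4 * p0 * q0\<close> and \<open>p0 * q0\<close>, which explains the factor 4.\<close>

lemma isect_mass_rectangle_ge:
  fixes f g :: "'a set \<Rightarrow> real" and e :: real
  assumes U: "finite U" and e: "0 < e" "e \<le> 1"
    and f: "\<And>x. 0 \<le> f x" "\<And>x. f x \<le> 1" and g: "\<And>x. 0 \<le> g x" "\<And>x. g x \<le> 1"
  shows "4 * isect_mass U (\<lambda>x y. f x * g y)
    \<ge> (1 - 10 * e) * card U * disj_mass U (\<lambda>x y. f x * g y) - 10 * 4 ^ card U * tail_err e (card U)"
proof -
  define M where "M = disj_mass U (\<lambda>x y. f x * g y)"
  define err where "err = e * card U * M + 4 ^ card U * tail_err e (card U)"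
  define p0 where "p0 i T = (\<Sum>x\<in>Pow T. f x)" for i :: 'a and T
  define p1 where "p1 i T = (\<Sum>x\<in>Pow T. f (insert i x))" for i T
  define q0 where "q0 i T = (\<Sum>x\<in>Pow (U - {i} - T). g x)" for i T
  define q1 where "q1 i T = (\<Sum>x\<in>Pow (U - {i} - T). g (insert i x))" for i T
  define S :: "('a \<Rightarrow> 'a set \<Rightarrow> real) \<Rightarrow> real" where "S F = (\<Sum>i\<in>U. \<Sum>T\<in>Pow (U - {i}). F i T)" for F
  have nn: "0 \<le> p0 i T" "0 \<le> p1 i T" "0 \<le> q0 i T" "0 \<le> q1 i T" for i T
    unfolding p0_def p1_def q0_def q1_def using f g by (auto intro: sum_nonneg)
  have A: "S (\<lambda>i T. \<bar>p1 i T - p0 i T\<bar> * q0 i T) \<le> err"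
    unfolding S_def p0_def p1_def q0_def err_def M_def
    by (rule first_order_defect_le) (use assms in auto)
  have "S (\<lambda>i T. p0 i T * \<bar>q1 i T - q0 i T\<bar>)
      = (\<Sum>i\<in>U. \<Sum>T\<in>Pow (U - {i}).
       \<bar>(\<Sum>x\<in>Pow T. g (insert i x)) - (\<Sum>x\<in>Pow T. g x)\<bar> * (\<Sum>y\<in>Pow (U - {i} - T). f y))"
    unfolding S_def p0_def q0_def q1_def
  proof (rule sum.cong[OF refl])
    fix i
    show "(\<Sum>T\<in>Pow (U - {i}). (\<Sum>x\<in>Pow T. f x) *
        \<bar>(\<Sum>x\<in>Pow (U - {i} - T). g (insert i x)) - (\<Sum>x\<in>Pow (U - {i} - T). g x)\<bar>)
      = (\<Sum>T\<in>Pow (U - {i}).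
       \<bar>(\<Sum>x\<in>Pow T. g (insert i x)) - (\<Sum>x\<in>Pow T. g x)\<bar> * (\<Sum>y\<in>Pow (U - {i} - T). f y))"
      by (rule sum.reindex_bij_witness[of _ "\<lambda>T. U - {i} - T" "\<lambda>T. U - {i} - T"])
         (auto simp: double_diff)
  qed
  also have "\<dots> \<le> e * card U * disj_mass U (\<lambda>x y. g x * f y) + 4 ^ card U * tail_err e (card U)"
    by (rule first_order_defect_le) (use assms in auto)
  also have "\<dots> = err"
    unfolding err_def M_def by (subst disj_mass_swap) (simp add: mult.commute)
  finally have B: "S (\<lambda>i T. p0 i T * \<bar>q1 i T - q0 i T\<bar>) \<le> err" .
  \<comment> \<open>Condition on the owner of \<open>i\<close>: outside \<open>T\<close> it is
    available to \<open>y\<close> only, inside \<open>T\<close> to \<open>x\<close> only.\<close>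
  have split: "M = (\<Sum>T\<in>Pow (U - {i}). p0 i T * (q0 i T + q1 i T) + (p0 i T + p1 i T) * q0 i T)"
    if i: "i \<in> U" for i
  proof -
    have "M = (\<Sum>T\<in>Pow U. (\<Sum>x\<in>Pow T. f x) * (\<Sum>y\<in>Pow (U - T). g y))"
      unfolding M_def disj_mass_def by (simp add: sum_product)
    also have "\<dots> = (\<Sum>T\<in>Pow (U - {i}). (\<Sum>x\<in>Pow T. f x) * (\<Sum>y\<in>Pow (U - T). g y))
       + (\<Sum>T\<in>Pow (U - {i}). (\<Sum>x\<in>Pow (insert i T). f x) * (\<Sum>y\<in>Pow (U - insert i T). g y))"
      by (rule sum_Pow_split[OF U i])
    also have "(\<Sum>T\<in>Pow (U - {i}). (\<Sum>x\<in>Pow T. f x) * (\<Sum>y\<in>Pow (U - T). g y))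
        = (\<Sum>T\<in>Pow (U - {i}). p0 i T * (q0 i T + q1 i T))"
    proof (rule sum.cong[OF refl])
      fix T assume T: "T \<in> Pow (U - {i})"
      have "finite (U - T)" "i \<in> U - T" "U - T - {i} = U - {i} - T" using T U i by auto
      then show "(\<Sum>x\<in>Pow T. f x) * (\<Sum>y\<in>Pow (U - T). g y) = p0 i T * (q0 i T + q1 i T)"
        unfolding p0_def q0_def q1_def using sum_Pow_split[of "U - T" i g] by simp
    qed
    also have "(\<Sum>T\<in>Pow (U - {i}). (\<Sum>x\<in>Pow (insert i T). f x) * (\<Sum>y\<in>Pow (U - insert i T). g y))
        = (\<Sum>T\<in>Pow (U - {i}). (p0 i T + p1 i T) * q0 i T)"
    proof (rule sum.cong[OF refl])
      fix T assume T: "T \<in> Pow (U - {i})"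
      have "finite (insert i T)" "insert i T - {i} = T" "U - insert i T = U - {i} - T"
        using T U i by (auto intro: finite_subset)
      then show "(\<Sum>x\<in>Pow (insert i T). f x) * (\<Sum>y\<in>Pow (U - insert i T). g y) = (p0 i T + p1 i T) * q0 i T"
        unfolding p0_def p1_def q0_def using sum_Pow_split[of "insert i T" i f] by simp
    qed
    finally show ?thesis by (simp add: sum.distrib)
  qed
  have "card U * M = S (\<lambda>i T. p0 i T * (q0 i T + q1 i T) + (p0 i T + p1 i T) * q0 i T)"
  proof -
    have "S (\<lambda>i T. p0 i T * (q0 i T + q1 i T) + (p0 i T + p1 i T) * q0 i T) = (\<Sum>i\<in>U. M)"
      unfolding S_def by (intro sum.cong refl split[symmetric])
    then show ?thesis by simp
  qed
  also have "\<dots> \<le> S (\<lambda>i T. 4 * (p0 i T * q0 i T) + p0 i T * \<bar>q1 i T - q0 i T\<bar> + \<bar>p1 i T - p0 i T\<bar> * q0 i T)"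
    unfolding S_def
  proof (intro sum_mono)
    fix i T
    have "p0 i T * (q0 i T + q1 i T) \<le> p0 i T * (2 * q0 i T + \<bar>q1 i T - q0 i T\<bar>)"
      by (intro mult_left_mono nn) linarith
    moreover have "(p0 i T + p1 i T) * q0 i T \<le> (2 * p0 i T + \<bar>p1 i T - p0 i T\<bar>) * q0 i T"
      by (intro mult_right_mono nn) linarith
    ultimately show "p0 i T * (q0 i T + q1 i T) + (p0 i T + p1 i T) * q0 i T
      \<le> 4 * (p0 i T * q0 i T) + p0 i T * \<bar>q1 i T - q0 i T\<bar> + \<bar>p1 i T - p0 i T\<bar> * q0 i T"
      by (simp add: algebra_simps)
  qed
  also have "\<dots> = 4 * S (\<lambda>i T. p0 i T * q0 i T) + S (\<lambda>i T. p0 i T * \<bar>q1 i T - q0 i T\<bar>)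
      + S (\<lambda>i T. \<bar>p1 i T - p0 i T\<bar> * q0 i T)"
    unfolding S_def by (simp add: sum.distrib sum_distrib_left)
  finally have C: "card U * M \<le> 4 * S (\<lambda>i T. p0 i T * q0 i T) + 2 * err" using A B by linarith
  have "isect_mass U (\<lambda>x y. f x * g y) = S (\<lambda>i T. p1 i T * q1 i T)"
    unfolding isect_mass_def S_def p1_def q1_def by (simp add: sum_product)
  also have "\<dots> \<ge> S (\<lambda>i T. p0 i T * q0 i T - \<bar>p1 i T - p0 i T\<bar> * q0 i T - p0 i T * \<bar>q1 i T - q0 i T\<bar>)"
    unfolding S_def by (intro sum_mono mult_ge_perturbation nn)
  also have "S (\<lambda>i T. p0 i T * q0 i T - \<bar>p1 i T - p0 i T\<bar> * q0 i T - p0 i T * \<bar>q1 i T - q0 i T\<bar>)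
     = S (\<lambda>i T. p0 i T * q0 i T) - S (\<lambda>i T. \<bar>p1 i T - p0 i T\<bar> * q0 i T)
       - S (\<lambda>i T. p0 i T * \<bar>q1 i T - q0 i T\<bar>)"
    unfolding S_def by (simp add: sum_subtractf)
  \<comment> \<open>The 10 is \<open>4 * 2\<close> from this bound on the intersecting mass plus 2
    from \<open>C\<close>.\<close>
  finally have "4 * isect_mass U (\<lambda>x y. f x * g y) \<ge> card U * M - 10 * err"
    using A B C by linarith
  then show ?thesis unfolding err_def M_def by (simp add: algebra_simps)
qed

section \<open>Linearity, total masses, and the passage from rectangles to protocols\<close>

lemma disj_mass_add:
  "disj_mass U (\<lambda>x y. F x y + G x y) = disj_mass U F + disj_mass U G"
  unfolding disj_mass_def by (simp add: sum.distrib)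

lemma isect_mass_eq_disj_mass:
  "isect_mass U F = (\<Sum>i\<in>U. disj_mass (U - {i}) (\<lambda>x y. F (insert i x) (insert i y)))"
  unfolding isect_mass_def disj_mass_def ..

lemma disj_mass_sum:
  assumes "finite L"
  shows "disj_mass U (\<lambda>x y. \<Sum>l\<in>L. F l x y) = (\<Sum>l\<in>L. disj_mass U (F l))"
  using assms by induction (simp_all add: disj_mass_add, simp add: disj_mass_def)

lemma isect_mass_sum:
  assumes "finite L"
  shows "isect_mass U (\<lambda>x y. \<Sum>l\<in>L. F l x y) = (\<Sum>l\<in>L. isect_mass U (F l))"
  unfolding isect_mass_eq_disj_mass using assms by (simp add: disj_mass_sum, subst sum.swap, simp)

lemma disj_mass_const:
  fixes c :: real
  assumes U: "finite U"
  shows "disj_mass U (\<lambda>_ _. c) = 4 ^ card U * c"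
proof -
  have "disj_mass U (\<lambda>_ _. c) = (\<Sum>T\<in>Pow U. 2 ^ card U * c)"
    unfolding disj_mass_def
  proof (rule sum.cong[OF refl])
    fix T assume T: "T \<in> Pow U"
    then have "finite T" using U finite_subset by auto
    then have "(2::real) ^ card T * 2 ^ card (U - T) = 2 ^ card U"
      using T U by (simp add: power_add[symmetric] card_Diff_subset card_mono)
    then show "(\<Sum>x\<in>Pow T. \<Sum>y\<in>Pow (U - T). c) = 2 ^ card U * c"
      using U \<open>finite T\<close> by (simp add: card_Pow)
  qed
  also have "\<dots> = (2 ^ card U * 2 ^ card U) * c"
    using U by (simp add: card_Pow power_mult_distrib flip: mult.assoc)
  also have "(2 ^ card U * 2 ^ card U :: real) = 4 ^ card U"
    by (simp flip: power_mult_distrib)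
  finally show ?thesis .
qed

lemma isect_mass_const:
  fixes c :: real
  assumes U: "finite U"
  shows "4 * isect_mass U (\<lambda>_ _. c) = card U * 4 ^ card U * c"
proof -
  have "isect_mass U (\<lambda>_ _. c) = (\<Sum>i\<in>U. 4 ^ (card U - 1) * c)"
    unfolding isect_mass_eq_disj_mass using U by (intro sum.cong refl) (simp add: disj_mass_const)
  then show ?thesis
    by (cases "card U") (simp_all add: algebra_simps)
qed

text \<open>Labels play the role of transcripts. The accepted pairs with a given label form a
  rectangle, so the rectangle bound applies label by label and its additive error is paid
  \<open>card L\<close> times. Acceptance need not be determined by the label.\<close>

lemma isect_mass_protocol_ge:
  fixes lab :: "'a set \<Rightarrow> 'a set \<Rightarrow> 'l" and e :: real
  assumes U: "finite U" and L: "finite L" and e: "0 < e" "e \<le> 1"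
    and lab: "\<And>x y. lab x y \<in> L"
    and rect_lab: "\<And>x y x' y'. lab x y = lab x' y' \<Longrightarrow> lab x y' = lab x y"
    and rect_acc: "\<And>x y x' y'. lab x y = lab x' y' \<Longrightarrow> acc x y \<Longrightarrow> acc x' y' \<Longrightarrow> acc x y'"
  shows "4 * isect_mass U (\<lambda>x y. of_bool (acc x y))
    \<ge> (1 - 10 * e) * card U * disj_mass U (\<lambda>x y. of_bool (acc x y))
       - card L * (10 * 4 ^ card U * tail_err e (card U))"
proof -
  define f :: "'l \<Rightarrow> 'a set \<Rightarrow> real" where "f l x = of_bool (\<exists>y. lab x y = l \<and> acc x y)" for l x
  define g :: "'l \<Rightarrow> 'a set \<Rightarrow> real" where "g l y = of_bool (\<exists>x. lab x y = l \<and> acc x y)" for l y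
  have fg: "f l x * g l y = of_bool (lab x y = l \<and> acc x y)" for l x y
  proof -
    \<comment> \<open>Cut and paste: \<open>(x, y)\<close> combines the row of one accepted pair
      with the column of another.\<close>
    have "lab x y = l \<and> acc x y" if "lab x y' = l" "acc x y'" "lab x' y = l" "acc x' y" for x' y'
      using rect_lab[of x y' x' y] rect_acc[of x y' x' y] that by simp
    then have "(\<exists>y. lab x y = l \<and> acc x y) \<and> (\<exists>x. lab x y = l \<and> acc x y) \<longleftrightarrow> lab x y = l \<and> acc x y"
      by blast
    then show ?thesis unfolding f_def g_def of_bool_conj[symmetric] by simp
  qed
  have acc: "of_bool (acc x y) = (\<Sum>l\<in>L. f l x * g l y)" for x y
    unfolding fg using L lab[of x y] by (cases "acc x y") (simp_all add: of_bool_def)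
  have "(\<Sum>l\<in>L. 4 * isect_mass U (\<lambda>x y. f l x * g l y))
    \<ge> (\<Sum>l\<in>L. (1 - 10 * e) * card U * disj_mass U (\<lambda>x y. f l x * g l y)
        - 10 * 4 ^ card U * tail_err e (card U))"
    by (intro sum_mono isect_mass_rectangle_ge U e) (auto simp: f_def g_def)
  then show ?thesis
    unfolding acc disj_mass_sum[OF L] isect_mass_sum[OF L]
    by (simp add: sum_subtractf sum_distrib_left mult.assoc)
qed

section \<open>Averaging over public randomness\<close>

lemma integrable_pmf_bounded:
  fixes F :: "'r \<Rightarrow> real"
  assumes "\<And>r. \<bar>F r\<bar> \<le> B"
  shows "integrable (measure_pmf R) F"
  using assms by (intro measure_pmf.integrable_const_bound[of _ B]) auto

lemma disj_mass_expectation: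
  fixes F :: "'r \<Rightarrow> 'a set \<Rightarrow> 'a set \<Rightarrow> real"
  assumes "\<And>x y. integrable (measure_pmf R) (\<lambda>r. F r x y)"
  shows "measure_pmf.expectation R (\<lambda>r. disj_mass U (F r))
      = disj_mass U (\<lambda>x y. measure_pmf.expectation R (\<lambda>r. F r x y))"
    and "integrable (measure_pmf R) (\<lambda>r. disj_mass U (F r))"
  unfolding disj_mass_def using assms
  by (simp_all add: Bochner_Integration.integral_sum Bochner_Integration.integrable_sum)

lemma isect_mass_expectation:
  fixes F :: "'r \<Rightarrow> 'a set \<Rightarrow> 'a set \<Rightarrow> real"
  assumes "\<And>x y. integrable (measure_pmf R) (\<lambda>r. F r x y)"
  shows "measure_pmf.expectation R (\<lambda>r. isect_mass U (F r))
      = isect_mass U (\<lambda>x y. measure_pmf.expectation R (\<lambda>r. F r x y))"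
    and "integrable (measure_pmf R) (\<lambda>r. isect_mass U (F r))"
  unfolding isect_mass_def using assms
  by (simp_all add: Bochner_Integration.integral_sum Bochner_Integration.integrable_sum)

lemma disj_mass_mono:
  assumes "\<And>x y. x \<subseteq> U \<Longrightarrow> y \<subseteq> U \<Longrightarrow> x \<inter> y = {} \<Longrightarrow> F x y \<le> G x y"
  shows "disj_mass U F \<le> disj_mass U G"
  unfolding disj_mass_def by (intro sum_mono assms) auto

lemma isect_mass_mono:
  assumes "\<And>x y. x \<subseteq> U \<Longrightarrow> y \<subseteq> U \<Longrightarrow> x \<inter> y \<noteq> {} \<Longrightarrow> F x y \<le> G x y"
  shows "isect_mass U F \<le> isect_mass U G"
  unfolding isect_mass_def by (intro sum_mono assms) auto

text \<open>The deterministic bound is averaged over \<open>R\<close>. Success probability forces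
  disjoint mass at least \<open>2/3\<close> and intersecting mass at most \<open>1/3\<close> of the
  totals, which contradicts near-proportionality unless the error term, hence \<open>card L\<close>,
  is large.\<close>

lemma randomized_disjointness_lower_bound:
  fixes R :: "'r pmf" and lab :: "'r \<Rightarrow> 'a set \<Rightarrow> 'a set \<Rightarrow> 'l"
  assumes U: "finite U" and L: "finite L"
    and lab: "\<And>r x y. r \<in> set_pmf R \<Longrightarrow> lab r x y \<in> L"
    and rect_lab: "\<And>r x y x' y'. r \<in> set_pmf R \<Longrightarrow> lab r x y = lab r x' y' \<Longrightarrow> lab r x y' = lab r x y"
    and rect_acc: "\<And>r x y x' y'. r \<in> set_pmf R \<Longrightarrow> lab r x y = lab r x' y' \<Longrightarrow>
        acc r x y \<Longrightarrow> acc r x' y' \<Longrightarrow> acc r x y'"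
    and disj: "\<And>x y. x \<subseteq> U \<Longrightarrow> y \<subseteq> U \<Longrightarrow> x \<inter> y = {} \<Longrightarrow>
        measure_pmf.prob R {r. acc r x y} \<ge> 2 / 3"
    and isect: "\<And>x y. x \<subseteq> U \<Longrightarrow> y \<subseteq> U \<Longrightarrow> x \<inter> y \<noteq> {} \<Longrightarrow>
        measure_pmf.prob R {r. acc r x y} \<le> 1 / 3"
  shows "card U * exp (card U / 6400) \<le> 4800 * real (card L)"
proof -
  define N where "N = card U"
  \<comment> \<open>Any \<open>e < 1/20\<close> leaves a gap, as
    \<open>(1 - 10 * e) * 2/3 > 1/3\<close>. The choice \<open>1/40\<close> gives slope
    \<open>3/4\<close>, gap \<open>N * 4 ^ N / 6\<close>, exponent \<open>N / 6400\<close> and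
    \<open>6 * 10 * 80 = 4800\<close>.\<close>
  define err where "err = 10 * 4 ^ N * tail_err (1 / 40) N"
  define D where "D r = disj_mass U (\<lambda>x y. of_bool (acc r x y))" for r
  define X where "X r = isect_mass U (\<lambda>x y. of_bool (acc r x y))" for r
  have ib: "integrable (measure_pmf R) (\<lambda>r. of_bool (acc r x y) :: real)" for x y
    by (intro integrable_pmf_bounded[of _ 1]) auto
  have ev: "measure_pmf.expectation R (\<lambda>r. of_bool (acc r x y)) = measure_pmf.prob R {r. acc r x y}" for x y
  proof -
    have "(\<lambda>r. of_bool (acc r x y) :: real) = indicator {r. acc r x y}"
      by (auto simp: fun_eq_iff indicator_def)
    then show ?thesis by simp
  qed
  note ED = disj_mass_expectation[where U = U and F = "\<lambda>r x y. of_bool (acc r x y)", OF ib, folded D_def, unfolded ev]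
  note EX = isect_mass_expectation[where U = U and F = "\<lambda>r x y. of_bool (acc r x y)", OF ib, folded X_def, unfolded ev]
  have pw: "4 * X r - 3 / 4 * N * D r \<ge> - (card L * err)" if "r \<in> set_pmf R" for r
  proof -
    have "4 * X r \<ge> (1 - 10 * (1 / 40)) * card U * D r - card L * (10 * 4 ^ card U * tail_err (1 / 40) (card U))"
      unfolding X_def D_def
    proof (rule isect_mass_protocol_ge[OF U L, where lab = "lab r"])
      show "lab r x y \<in> L" for x y
        using that by (rule lab)
      show "lab r x y' = lab r x y" if "lab r x y = lab r x' y'" for x y x' y'
        using \<open>r \<in> set_pmf R\<close> that by (rule rect_lab)
      show "acc r x y'" if "lab r x y = lab r x' y'" "acc r x y" "acc r x' y'" for x y x' y'
        using \<open>r \<in> set_pmf R\<close> that by (rule rect_acc)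
    qed simp_all
    then show ?thesis by (simp add: err_def N_def mult.assoc)
  qed
  have "- (card L * err) \<le> measure_pmf.expectation R (\<lambda>r. 4 * X r - 3 / 4 * N * D r)"
    using pw ED(2) EX(2)
    by (intro measure_pmf.integral_ge_const Bochner_Integration.integrable_diff) (auto simp: AE_measure_pmf_iff)
  also have "\<dots> = 4 * isect_mass U (\<lambda>x y. measure_pmf.prob R {r. acc r x y})
      - 3 / 4 * N * disj_mass U (\<lambda>x y. measure_pmf.prob R {r. acc r x y})"
    using ED EX by simp
  also have "\<dots> \<le> 4 * isect_mass U (\<lambda>x y. 1 / 3) - 3 / 4 * N * disj_mass U (\<lambda>x y. 2 / 3)"
    using disj isect by (intro diff_mono mult_left_mono isect_mass_mono disj_mass_mono) auto
  also have "\<dots> = - (N * 4 ^ N / 6)"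
    using isect_mass_const[OF U, of "1/3"] disj_mass_const[OF U, of "2/3"]
    by (simp add: N_def field_simps)
  finally have "4 ^ N * real N \<le> 4 ^ N * (4800 * card L * exp (- (N / 6400)))"
    by (simp add: err_def tail_err_def power2_eq_square)
  then have "real N \<le> 4800 * card L * exp (- (N / 6400))"
    by (rule mult_left_le_imp_le) simp
  then have "N * exp (N / 6400) \<le> 4800 * card L * exp (- (N / 6400)) * exp (N / 6400)"
    by (intro mult_right_mono) auto
  then show ?thesis by (simp add: mult_exp_exp mult.assoc N_def)
qed

section \<open>Simulating a network across a cut\<close>

lemma adj_local_input:
  "adj I u v \<longleftrightarrow> li_out (local_input I v) u \<noteq> None \<or> li_in (local_input I v) u \<noteq> None"
  by (auto simp: adj_def local_input_def)

text \<open>Each player can simulate one side of the network, learning from the other only what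
  crosses \<open>Cut\<close>. The topology inside a side may depend on that player's input, but the
  crossing links may not.\<close>

locale two_party_network =
  fixes J :: "'x \<Rightarrow> 'y \<Rightarrow> inst" and Bob :: "nat set" and Cut :: "(nat \<times> nat) set"
  assumes alice_input: "v \<notin> Bob \<Longrightarrow> local_input (J x y) v = local_input (J x y') v"
    and bob_input: "v \<in> Bob \<Longrightarrow> local_input (J x y) v = local_input (J x' y) v"
    and cut: "(u \<in> Bob) \<noteq> (v \<in> Bob) \<Longrightarrow> adj (J x y) u v \<longleftrightarrow> (u, v) \<in> Cut"
    and cut_crosses: "(u, v) \<in> Cut \<Longrightarrow> (u \<in> Bob) \<noteq> (v \<in> Bob)"
    and finite_cut: "finite Cut"
begin

text \<open>The function is restricted to its finite domain so that transcripts lie in a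
  \<open>PiE\<close> and can be counted.\<close>

definition transcript :: "'o dalg \<Rightarrow> nat \<Rightarrow> 'x \<Rightarrow> 'y \<Rightarrow> nat \<times> nat \<times> nat \<Rightarrow> bool list" where
  "transcript A T x y = (\<lambda>(i, u, v) \<in> {..<T} \<times> Cut. msg A (local_input (J x y) u) (hist A (J x y) i u) v)"

text \<open>Cut and paste, by induction on rounds: on the mixed input each side sees its own old
  input, and the messages entering it over the cut agree in the two original runs.\<close>

lemma hist_rectangle:
  assumes eq: "transcript A T x y = transcript A T x' y'" and "i \<le> T"
  shows "(v \<notin> Bob \<longrightarrow> hist A (J x y') i v = hist A (J x y) i v)
       \<and> (v \<in> Bob \<longrightarrow> hist A (J x y') i v = hist A (J x' y') i v)"
  using \<open>i \<le> T\<close>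
proof (induction i arbitrary: v)
  case 0
  show ?case by simp
next
  case (Suc i)
  have IH: "u \<notin> Bob \<Longrightarrow> hist A (J x y') i u = hist A (J x y) i u"
       "u \<in> Bob \<Longrightarrow> hist A (J x y') i u = hist A (J x' y') i u" for u
    using Suc by auto
  have same: "msg A (local_input (J x y) u) (hist A (J x y) i u) v
      = msg A (local_input (J x' y') u) (hist A (J x' y') i u) v" if "(u, v) \<in> Cut" for u v
    using fun_cong[OF eq, of "(i, u, v)"] that Suc.prems by (simp add: transcript_def)
  show ?case
  proof (intro conjI impI)
    assume v: "v \<notin> Bob"
    have "adj (J x y') u v = adj (J x y) u v" for u
      using alice_input[OF v] adj_local_input by metis
    moreover have "msg A (local_input (J x y') u) (hist A (J x y') i u) v
        = msg A (local_input (J x y) u) (hist A (J x y) i u) v" if "adj (J x y) u v" for u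
    proof (cases "u \<in> Bob")
      case True
      then show ?thesis using IH(2)[OF True] bob_input[OF True] same cut[of u v x y] v that by metis
    next
      case False
      then show ?thesis using IH(1)[OF False] alice_input[OF False] by metis
    qed
    ultimately show "hist A (J x y') (Suc i) v = hist A (J x y) (Suc i) v"
      using IH(1)[OF v] by auto
  next
    assume v: "v \<in> Bob"
    have "adj (J x y') u v = adj (J x' y') u v" for u
      using bob_input[OF v] adj_local_input by metis
    moreover have "msg A (local_input (J x y') u) (hist A (J x y') i u) v
        = msg A (local_input (J x' y') u) (hist A (J x' y') i u) v" if "adj (J x' y') u v" for u
    proof (cases "u \<in> Bob")
      case True
      then show ?thesis using IH(2)[OF True] bob_input[OF True] by metis
    next
      case False
      then show ?thesis using IH(1)[OF False] alice_input[OF False] same cut[of u v x' y'] v that by metis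
    qed
    ultimately show "hist A (J x y') (Suc i) v = hist A (J x' y') (Suc i) v"
      using IH(2)[OF v] by auto
  qed
qed

text \<open>Every recorded message has a sender on one side, which behaves on the mixed input as in
  one of the two original runs; these have the same transcript.\<close>

lemma transcript_rectangle:
  assumes eq: "transcript A T x y = transcript A T x' y'"
  shows "transcript A T x y' = transcript A T x y"
proof
  fix t :: "nat \<times> nat \<times> nat"
  obtain i u v where t: "t = (i, u, v)" by (cases t)
  show "transcript A T x y' t = transcript A T x y t"
  proof (cases "i < T \<and> (u, v) \<in> Cut")
    case True
    then have i: "i \<le> T" by simp
    show ?thesis
    proof (cases "u \<in> Bob")
      case u: True
      have "transcript A T x y' t = transcript A T x' y' t"
        using hist_rectangle[OF eq i, of u] u bob_input[OF u, of x y' x'] True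
        by (simp add: t transcript_def)
      then show ?thesis by (simp add: eq)
    next
      case u: False
      then show ?thesis
        using hist_rectangle[OF eq i, of u] alice_input[OF u, of x y' y] True
        by (simp add: t transcript_def)
    qed
  next
    case False
    then show ?thesis by (auto simp: t transcript_def)
  qed
qed

text \<open>Acceptance is a conjunction of conditions on single outputs, so it splits into one
  condition per side and no final exchange of outputs is required.\<close>

lemma outputs_rectangle:
  assumes eq: "transcript A T x y = transcript A T x' y'"
    and "\<forall>v<n. good (run A (J x y) T v)" "\<forall>v<n. good (run A (J x' y') T v)"
  shows "\<forall>v<n. good (run A (J x y') T v)"
proof (intro allI impI)
  fix v assume "v < n"
  have "run A (J x y') T v = (if v \<in> Bob then run A (J x' y') T v else run A (J x y) T v)"
    using hist_rectangle[OF eq le_refl, of v] alice_input[of v x y' y] bob_input[of v x y' x']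
    by (simp add: run_def)
  then show "good (run A (J x y') T v)" using assms \<open>v < n\<close> by simp
qed

end

lemma finite_bit_strings: "finite {l :: bool list. length l \<le> B}"
  and card_bit_strings: "card {l :: bool list. length l \<le> B} \<le> 2 ^ (B + 1)"
proof -
  show "finite {l :: bool list. length l \<le> B}"
    using finite_lists_length_le[of "UNIV :: bool set" B] by simp
  have "card {l :: bool list. length l \<le> B} = (\<Sum>i\<le>B. 2 ^ i)"
    using card_lists_length_le[of "UNIV :: bool set" B] by simp
  also have "\<dots> \<le> 2 ^ (B + 1)"
    by (induction B) auto
  finally show "card {l :: bool list. length l \<le> B} \<le> 2 ^ (B + 1)" .
qed

text \<open>Labels are transcripts, of which there are at most \<open>2 ^ (B + 1)\<close> per round
  and cut pair. A correct run has all outputs \<open>good\<close> exactly on disjoint inputs, so the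
  error probability carries over to both cases of disjointness.\<close>

lemma congest_cut_lower_bound:
  fixes R :: "'o dalg pmf" and J :: "'a set \<Rightarrow> 'a set \<Rightarrow> inst"
  assumes net: "two_party_network J Bob Cut" and U: "finite U"
    and bw: "bandwidth_ok R B" and sol: "solves C R n Wm D T"
    and valid: "\<And>x y. x \<subseteq> U \<Longrightarrow> y \<subseteq> U \<Longrightarrow> valid_inst n Wm D (J x y)"
    and disj: "\<And>x y Out. x \<subseteq> U \<Longrightarrow> y \<subseteq> U \<Longrightarrow> x \<inter> y = {} \<Longrightarrow> C (J x y) Out \<Longrightarrow> \<forall>v<n. good (Out v)"
    and isect: "\<And>x y Out. x \<subseteq> U \<Longrightarrow> y \<subseteq> U \<Longrightarrow> x \<inter> y \<noteq> {} \<Longrightarrow> C (J x y) Out \<Longrightarrow> \<exists>v<n. \<not> good (Out v)"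
  shows "card U * exp (card U / 6400) \<le> 4800 * 2 ^ ((B + 1) * (T * card Cut))"
proof -
  interpret two_party_network J Bob Cut by (rule net)
  define L where "L = PiE ({..<T} \<times> Cut) (\<lambda>_. {l :: bool list. length l \<le> B})"
  define acc where "acc A x y \<longleftrightarrow> (\<forall>v<n. good (run A (J x y) T v))" for A :: "'o dalg" and x y
  have ok: "measure_pmf.prob R {A. C (J x y) (run A (J x y) T)} \<ge> 2 / 3" if "x \<subseteq> U" "y \<subseteq> U" for x y
    using sol valid[OF that] by (auto simp: solves_def)
  have "card U * exp (card U / 6400) \<le> 4800 * real (card L)"
  proof (rule randomized_disjointness_lower_bound[where R = R and lab = "\<lambda>A. transcript A T" and acc = acc])
    show "finite U" by (rule U)
    show "finite L" unfolding L_def using finite_cut by (intro finite_PiE finite_bit_strings) auto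
    show "transcript A T x y \<in> L" if "A \<in> set_pmf R" for A x y
      using that bw by (auto simp: L_def transcript_def bandwidth_ok_def)
    show "transcript A T x y' = transcript A T x y" if "transcript A T x y = transcript A T x' y'" for A x y x' y'
      using that by (rule transcript_rectangle)
    show "acc A x y'" if "transcript A T x y = transcript A T x' y'" "acc A x y" "acc A x' y'" for A x y x' y'
      using outputs_rectangle[OF that(1), of n good] that(2,3) by (simp add: acc_def)
    show "measure_pmf.prob R {A. acc A x y} \<ge> 2 / 3" if "x \<subseteq> U" "y \<subseteq> U" "x \<inter> y = {}" for x y
    proof -
      have "{A. C (J x y) (run A (J x y) T)} \<subseteq> {A. acc A x y}"
        using disj[OF that] by (auto simp: acc_def)
      then have "measure_pmf.prob R {A. C (J x y) (run A (J x y) T)} \<le> measure_pmf.prob R {A. acc A x y}"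
        by (intro measure_pmf.finite_measure_mono) auto
      then show ?thesis using ok[OF that(1,2)] by linarith
    qed
    show "measure_pmf.prob R {A. acc A x y} \<le> 1 / 3" if "x \<subseteq> U" "y \<subseteq> U" "x \<inter> y \<noteq> {}" for x y
    proof -
      have "{A. C (J x y) (run A (J x y) T)} \<subseteq> UNIV - {A. acc A x y}"
        using isect[OF that] by (auto simp: acc_def)
      then have "measure_pmf.prob R {A. C (J x y) (run A (J x y) T)} \<le> measure_pmf.prob R (UNIV - {A. acc A x y})"
        by (intro measure_pmf.finite_measure_mono) auto
      also have "\<dots> = 1 - measure_pmf.prob R {A. acc A x y}"
        using measure_pmf.prob_compl[of "{A. acc A x y}" R] by simp
      finally show ?thesis using ok[OF that(1,2)] by linarith
    qed
  qed
  moreover have "real (card L) \<le> 2 ^ ((B + 1) * (T * card Cut))"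
  proof -
    have "card L = card {l :: bool list. length l \<le> B} ^ (T * card Cut)"
      unfolding L_def using finite_cut by (simp add: card_PiE card_cartesian_product)
    also have "\<dots> \<le> (2 ^ (B + 1)) ^ (T * card Cut)"
      by (rule power_mono[OF card_bit_strings]) simp
    finally have "real (card L) \<le> real ((2 ^ (B + 1)) ^ (T * card Cut))"
      by (rule of_nat_mono)
    then show ?thesis by (simp only: power_mult[symmetric] of_nat_power of_nat_numeral)
  qed
  ultimately show ?thesis by linarith
qed

section \<open>The hard instances\<close>

lemma path_edges_Cons2: "path_edges (a # b # p) = insert (a, b) (path_edges (b # p))"
  by (simp add: path_edges_def)

lemma path_edges_single: "path_edges [a] = {}"
  by (simp add: path_edges_def)

lemma path_weight_Cons2: "path_weight I (a # b # p) = wt I (a, b) + path_weight I (b # p)"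
  by (simp add: path_weight_def)

lemma path_weight_single: "path_weight I [a] = 0"
  by (simp add: path_weight_def)

lemma zip_tl_append:
  assumes "p \<noteq> []" "q \<noteq> []"
  shows "zip (p @ q) (tl (p @ q)) = zip p (tl p) @ (last p, hd q) # zip q (tl q)"
  using assms
proof (induction p)
  case (Cons a p)
  then show ?case by (cases p; cases q) auto
qed simp

lemma path_edges_append:
  assumes "p \<noteq> []" "q \<noteq> []"
  shows "path_edges (p @ q) = insert (last p, hd q) (path_edges p \<union> path_edges q)"
  using zip_tl_append[OF assms] by (auto simp: path_edges_def)

lemma path_weight_append:
  assumes "p \<noteq> []" "q \<noteq> []"
  shows "path_weight I (p @ q) = path_weight I p + wt I (last p, hd q) + path_weight I q"
  using zip_tl_append[OF assms] by (simp add: path_weight_def)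

lemma path_edges_upt: "path_edges [a..<b] = {(i, Suc i) | i. a \<le> i \<and> Suc i < b}"
proof -
  have "zip [a..<b] (tl [a..<b]) = map (\<lambda>i. (i, Suc i)) [a..<b - 1]"
    by (rule nth_equalityI) (auto simp: nth_tl)
  then show ?thesis by (auto simp: path_edges_def)
qed

lemma path_weight_eq_0:
  assumes "\<And>e. e \<in> path_edges p \<Longrightarrow> wt I e = 0"
  shows "path_weight I p = 0"
  using assms by (auto simp: path_weight_def path_edges_def)

text \<open>Weak duality for shortest paths: a feasible potential certifies a lower bound without
  any analysis of the shape of the path.\<close>

lemma potential_le_path_weight:
  assumes "p \<noteq> []" "\<And>u v. (u, v) \<in> path_edges p \<Longrightarrow> \<phi> v \<le> \<phi> u + wt I (u, v)"
  shows "\<phi> (last p) \<le> \<phi> (hd p) + path_weight I p"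
  using assms
proof (induction p rule: induct_list012)
  case (3 a b p)
  have "\<phi> (last (b # p)) \<le> \<phi> b + path_weight I (b # p)"
    using 3 by (simp add: path_edges_Cons2)
  moreover have "\<phi> b \<le> \<phi> a + wt I (a, b)"
    using 3(4) by (simp add: path_edges_Cons2)
  ultimately show ?case by (simp add: path_weight_Cons2)
qed (simp_all add: path_weight_single)

text \<open>The vertices are the path \<open>0, \<dots>, m\<close>, then blocks of \<open>m\<close> vertices
  \<open>c\<^sub>j = m + 1 + j\<close>, \<open>d\<^sub>j = 2 * m + 1 + j\<close>, \<open>r\<^sub>i = 3 * m + 1 + i\<close>, then the sink
  \<open>4 * m + 1\<close> which keeps the undirected diameter small, and padding. A detour
  \<open>i \<rightarrow> c\<^sub>j \<rightarrow> d\<^sub>j \<rightarrow> r\<^sub>k \<rightarrow> k + 1\<close> exists iff \<open>(i, j) \<in> x\<close> and \<open>(k, j) \<in> y\<close>, and costs \<open>m - i + k\<close>;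
  it skips a path edge only if \<open>i \<le> k\<close>, and then costs \<open>m\<close> iff \<open>i = k\<close>.\<close>

definition gadget :: "nat \<Rightarrow> nat \<Rightarrow> (nat \<times> nat) set \<Rightarrow> (nat \<times> nat) set \<Rightarrow> inst" where
  "gadget n m x y = \<lparr> nv = n,
     E = {(i, Suc i) | i. i < m}
       \<union> {(i, m + 1 + j) | i j. i < m \<and> j < m \<and> (i, j) \<in> x}
       \<union> {(m + 1 + j, 2 * m + 1 + j) | j. j < m}
       \<union> {(2 * m + 1 + j, 3 * m + 1 + i) | i j. i < m \<and> j < m \<and> (i, j) \<in> y}
       \<union> {(3 * m + 1 + i, Suc i) | i. i < m}
       \<union> {(v, 4 * m + 1) | v. v < n \<and> v \<noteq> 4 * m + 1},
     wt = (\<lambda>(u, v). if u < m \<and> m < v then m - u else if 3 * m + 1 \<le> u \<and> v \<le> m then v - 1 else 0),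
     src = 0, tgt = m, P = [0..<Suc m] \<rparr>"

lemma gadget_sel [simp]:
  "nv (gadget n m x y) = n" "src (gadget n m x y) = 0" "tgt (gadget n m x y) = m"
  "P (gadget n m x y) = [0..<Suc m]"
  "wt (gadget n m x y) = (\<lambda>(u, v). if u < m \<and> m < v then m - u else if 3 * m + 1 \<le> u \<and> v \<le> m then v - 1 else 0)"
  by (simp_all add: gadget_def)

lemma gadget_E:
  "(u, v) \<in> E (gadget n m x y) \<longleftrightarrow>
     (u < m \<and> v = Suc u)
   \<or> (\<exists>j<m. u < m \<and> v = m + 1 + j \<and> (u, j) \<in> x)
   \<or> (\<exists>j<m. u = m + 1 + j \<and> v = 2 * m + 1 + j)
   \<or> (\<exists>i<m. \<exists>j<m. u = 2 * m + 1 + j \<and> v = 3 * m + 1 + i \<and> (i, j) \<in> y)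
   \<or> (\<exists>i<m. u = 3 * m + 1 + i \<and> v = Suc i)
   \<or> (v = 4 * m + 1 \<and> u < n \<and> u \<noteq> 4 * m + 1)"
  unfolding gadget_def by (simp, blast)

lemma gadget_path_edges: "path_edges (P (gadget n m x y)) = {(k, Suc k) | k. k < m}"
  by (auto simp: path_edges_upt simp del: upt_Suc)

text \<open>The blocks \<open>d\<close> and \<open>r\<close>. The path, the block \<open>c\<close>,
  the sink and the padding are left to Alice.\<close>

definition gadget_bob :: "nat \<Rightarrow> nat set" where
  "gadget_bob m = {2 * m + 1..<4 * m + 1}"

definition gadget_link :: "nat \<Rightarrow> (nat \<times> nat) set" where
  "gadget_link m = (\<lambda>j. (m + 1 + j, 2 * m + 1 + j)) ` {..<m} \<union> (\<lambda>i. (3 * m + 1 + i, Suc i)) ` {..<m}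
     \<union> (\<lambda>v. (v, 4 * m + 1)) ` gadget_bob m"

text \<open>Links carry messages both ways, so each crossing edge occurs in both
  orientations.\<close>

definition gadget_cut :: "nat \<Rightarrow> (nat \<times> nat) set" where
  "gadget_cut m = gadget_link m \<union> prod.swap ` gadget_link m"

lemma finite_gadget_cut: "finite (gadget_cut m)"
  by (simp add: gadget_cut_def gadget_link_def gadget_bob_def)

lemma card_gadget_cut: "card (gadget_cut m) \<le> 8 * m"
proof -
  have "card (gadget_link m) \<le> m + m + card (gadget_bob m)"
    unfolding gadget_link_def
    by (intro order_trans[OF card_Un_le] add_mono order_trans[OF card_image_le])
       (auto simp: gadget_bob_def)
  also have "\<dots> = 4 * m" by (simp add: gadget_bob_def)
  finally have "card (gadget_link m) \<le> 4 * m" .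
  moreover have "card (prod.swap ` gadget_link m) \<le> card (gadget_link m)"
    by (intro card_image_le) (simp add: gadget_link_def gadget_bob_def)
  ultimately show ?thesis
    unfolding gadget_cut_def using card_Un_le[of "gadget_link m" "prod.swap ` gadget_link m"] by linarith
qed

lemma gadget_link_iff:
  "(u, v) \<in> gadget_link m \<longleftrightarrow> (\<exists>j<m. u = m + 1 + j \<and> v = 2 * m + 1 + j)
     \<or> (\<exists>i<m. u = 3 * m + 1 + i \<and> v = Suc i) \<or> (u \<in> gadget_bob m \<and> v = 4 * m + 1)"
  by (auto simp: gadget_link_def)

text \<open>Edges encoding \<open>x\<close> run from the path to block \<open>c\<close> and those
  encoding \<open>y\<close> from \<open>d\<close> to \<open>r\<close>, so neither kind crosses the
  cut.\<close>

lemma gadget_crossing_edge_iff: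
  assumes cross: "(u \<in> gadget_bob m) \<noteq> (v \<in> gadget_bob m)" and n: "4 * m + 2 \<le> n"
  shows "(u, v) \<in> E (gadget n m x y) \<longleftrightarrow> (u, v) \<in> gadget_link m"
proof
  assume "(u, v) \<in> E (gadget n m x y)"
  then show "(u, v) \<in> gadget_link m"
    using cross unfolding gadget_E gadget_link_iff by (elim disjE) (auto simp: gadget_bob_def)
next
  assume "(u, v) \<in> gadget_link m"
  then show "(u, v) \<in> E (gadget n m x y)"
    using n unfolding gadget_E gadget_link_iff by (elim disjE) (auto simp: gadget_bob_def)
qed

lemma gadget_two_party_network:
  assumes "4 * m + 2 \<le> n"
  shows "two_party_network (gadget n m) (gadget_bob m) (gadget_cut m)"
proof
  fix u v x y x' y'
  show "local_input (gadget n m x y) v = local_input (gadget n m x y') v" if "v \<notin> gadget_bob m"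
  proof -
    have "(v, u) \<in> E (gadget n m x y) \<longleftrightarrow> (v, u) \<in> E (gadget n m x y')"
         "(u, v) \<in> E (gadget n m x y) \<longleftrightarrow> (u, v) \<in> E (gadget n m x y')" for u
      using that unfolding gadget_E gadget_bob_def by auto
    then show ?thesis by (simp add: local_input_def cong: if_cong)
  qed
  show "local_input (gadget n m x y) v = local_input (gadget n m x' y) v" if "v \<in> gadget_bob m"
  proof -
    have "(v, u) \<in> E (gadget n m x y) \<longleftrightarrow> (v, u) \<in> E (gadget n m x' y)"
         "(u, v) \<in> E (gadget n m x y) \<longleftrightarrow> (u, v) \<in> E (gadget n m x' y)" for u
      using that unfolding gadget_E gadget_bob_def by auto
    then show ?thesis by (simp add: local_input_def cong: if_cong)
  qed
  show "adj (gadget n m x y) u v \<longleftrightarrow> (u, v) \<in> gadget_cut m"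
    if "(u \<in> gadget_bob m) \<noteq> (v \<in> gadget_bob m)"
  proof -
    have "(u, v) \<in> E (gadget n m x y) \<longleftrightarrow> (u, v) \<in> gadget_link m"
      using gadget_crossing_edge_iff[OF that assms] .
    moreover have "(v, u) \<in> E (gadget n m x y) \<longleftrightarrow> (v, u) \<in> gadget_link m"
      using gadget_crossing_edge_iff[OF that[symmetric] assms] .
    moreover have "(u, v) \<in> prod.swap ` gadget_link m \<longleftrightarrow> (v, u) \<in> gadget_link m"
      by force
    ultimately show ?thesis by (simp add: adj_def gadget_cut_def)
  qed
  show "(u \<in> gadget_bob m) \<noteq> (v \<in> gadget_bob m)" if "(u, v) \<in> gadget_cut m"
    using that by (auto simp: gadget_cut_def gadget_link_def gadget_bob_def)
  show "finite (gadget_cut m)" by (rule finite_gadget_cut)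
qed

text \<open>The sink is a neighbour of every other vertex; having no outgoing edges, it opens no new
  route to the target.\<close>

lemma gadget_diameter:
  assumes "4 * m + 2 \<le> n"
  shows "und_diam_le (gadget n m x y) 2"
  unfolding und_diam_le_def
proof (intro allI impI)
  fix u v assume u: "u < nv (gadget n m x y)" and v: "v < nv (gadget n m x y)"
  define h where "h = 4 * m + 1"
  have h: "h < n" using assms by (simp add: h_def)
  have adj: "adj (gadget n m x y) w h" "adj (gadget n m x y) h w" if "w < n" "w \<noteq> h" for w
    using that unfolding adj_def gadget_E h_def by auto
  let ?p = "if u = v then [u] else if u = h \<or> v = h then [u, v] else [u, h, v]"
  have "upath (gadget n m x y) ?p \<and> hd ?p = u \<and> last ?p = v \<and> length ?p \<le> Suc 2"
    using u v h adj by (auto simp: upath_def)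
  then show "\<exists>p. upath (gadget n m x y) p \<and> hd p = u \<and> last p = v \<and> length p \<le> Suc 2" ..
qed

lemma gadget_valid:
  assumes n: "4 * m + 2 \<le> n"
  shows "valid_inst n (n ^ 1) 2 (gadget n m x y)"
  unfolding valid_inst_def
proof (intro conjI)
  show "E (gadget n m x y) \<subseteq> {..<n} \<times> {..<n}"
    using n by (auto simp: gadget_E)
  show "\<forall>v. (v, v) \<notin> E (gadget n m x y)"
    by (auto simp: gadget_E)
  show "\<forall>e\<in>E (gadget n m x y). wt (gadget n m x y) e \<le> n ^ 1"
    using n by auto
  have P: "path_edges [0..<Suc m] = {(k, Suc k) | k. k < m}"
    using gadget_path_edges by simp
  have w: "path_weight (gadget n m x y) [0..<Suc m] = 0"
    unfolding P by (rule path_weight_eq_0) (auto simp: P simp del: upt_Suc)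
  show "shortest_st_path (gadget n m x y) (P (gadget n m x y))"
    using n w P by (auto simp: shortest_st_path_def simple_st_path_def st_path_def is_path_def gadget_E hd_upt simp del: upt_Suc)
  show "und_diam_le (gadget n m x y) 2" by (rule gadget_diameter[OF n])
qed (use n in auto)

text \<open>The potential below is feasible once the edge \<open>(k, Suc k)\<close> is banned, and
  it rises from 0 to \<open>m + 1\<close> between source and target.\<close>

lemma gadget_disjoint_weight:
  assumes k: "k < m" and disj: "x \<inter> y = {}" and p: "st_path (gadget n m x y) p"
    and avoid: "(k, Suc k) \<notin> path_edges p"
  shows "m < path_weight (gadget n m x y) p"
proof -
  \<comment> \<open>A lower bound on the distance from 0 without that edge. Leaving the path at
    \<open>k\<close> costs \<open>m - k\<close>, leaving earlier at least one more. Disjointness is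
    what allows \<open>m - k + 1\<close> at \<open>r\<close> with index \<open>k\<close>: a
    \<open>d\<close> vertex leading there by \<open>(k, j) \<in> y\<close> has
    \<open>(k, j) \<notin> x\<close>. Returning then costs at least \<open>k\<close>, and at least
    \<open>k + 1\<close> from a later \<open>r\<close>.\<close>
  define \<phi> where "\<phi> v =
    (if v \<le> k \<or> v > 4 * m then 0 else if v \<le> m then m + 1
     else if v \<le> 2 * m then (if (k, v - (m + 1)) \<in> x then m - k else m - k + 1)
     else if v \<le> 3 * m then (if (k, v - (2 * m + 1)) \<in> x then m - k else m - k + 1)
     else if v = 3 * m + 1 + k then m - k + 1 else m - k)" for v
  have "\<phi> v \<le> \<phi> u + wt (gadget n m x y) (u, v)" if uv: "(u, v) \<in> path_edges p" for u v
  proof -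
    have "(u, v) \<in> E (gadget n m x y)" "(u, v) \<noteq> (k, Suc k)"
      using uv avoid p by (auto simp: st_path_def is_path_def)
    then consider "u < m" "v = Suc u" "u \<noteq> k"
      | j where "j < m" "u < m" "v = m + 1 + j" "(u, j) \<in> x"
      | j where "j < m" "u = m + 1 + j" "v = 2 * m + 1 + j"
      | i j where "i < m" "j < m" "u = 2 * m + 1 + j" "v = 3 * m + 1 + i" "(i, j) \<in> y"
      | i where "i < m" "u = 3 * m + 1 + i" "v = Suc i"
      | "v = 4 * m + 1"
      unfolding gadget_E by blast
    then show ?thesis
    proof cases
      case 1
      then show ?thesis using k by (auto simp: \<phi>_def)
    next
      case 2
      then show ?thesis using k by (cases u k rule: linorder_cases) (auto simp: \<phi>_def)
    next
      case 3
      then show ?thesis using k by (auto simp: \<phi>_def)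
    next
      case 4
      then show ?thesis using k disj by (auto simp: \<phi>_def)
    next
      case 5
      then show ?thesis using k by (cases i k rule: linorder_cases) (auto simp: \<phi>_def)
    next
      case 6
      then show ?thesis by (simp add: \<phi>_def)
    qed
  qed
  then have "\<phi> (last p) \<le> \<phi> (hd p) + path_weight (gadget n m x y) p"
    using p by (intro potential_le_path_weight) (auto simp: st_path_def is_path_def)
  moreover have "hd p = 0" "last p = m" using p by (auto simp: st_path_def)
  ultimately show ?thesis using k by (simp add: \<phi>_def)
qed

lemma gadget_intersecting_path:
  assumes n: "4 * m + 2 \<le> n" and k: "k < m" "j < m" "(k, j) \<in> x" "(k, j) \<in> y"
  obtains p where "simple_st_path (gadget n m x y) p" "(k, Suc k) \<notin> path_edges p"
    "path_weight (gadget n m x y) p = m"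
proof
  let ?I = "gadget n m x y"
  let ?q = "[m + 1 + j, 2 * m + 1 + j, 3 * m + 1 + k]"
  \<comment> \<open>Leave the zero-weight path at \<open>k\<close> for \<open>m - k\<close> and
    rejoin it at \<open>Suc k\<close> for \<open>k\<close>, a total of \<open>m\<close>.\<close>
  let ?p = "[0..<Suc k] @ ?q @ [Suc k..<Suc m]"
  have ne: "[0..<Suc k] \<noteq> []" "[Suc k..<Suc m] \<noteq> []" "last [0..<Suc k] = k" "hd [Suc k..<Suc m] = Suc k"
    using k by (auto simp: hd_upt simp del: upt_Suc) 
  have pe: "path_edges ?p = {(i, Suc i) | i. i < k} \<union> {(i, Suc i) | i. k < i \<and> i < m}
     \<union> {(k, m + 1 + j), (m + 1 + j, 2 * m + 1 + j), (2 * m + 1 + j, 3 * m + 1 + k), (3 * m + 1 + k, Suc k)}"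
  proof -
    have "path_edges ?p = insert (k, m + 1 + j) (path_edges [0..<Suc k] \<union> path_edges (?q @ [Suc k..<Suc m]))"
      using ne by (subst path_edges_append) (auto simp del: upt_Suc)
    also have "path_edges (?q @ [Suc k..<Suc m])
        = insert (3 * m + 1 + k, Suc k) (path_edges ?q \<union> path_edges [Suc k..<Suc m])"
      using ne by (subst path_edges_append) (auto simp del: upt_Suc)
    also have "path_edges ?q = {(m + 1 + j, 2 * m + 1 + j), (2 * m + 1 + j, 3 * m + 1 + k)}"
      by (simp add: path_edges_Cons2 path_edges_single)
    also have "path_edges [0..<Suc k] = {(i, Suc i) | i. i < k}"
      by (auto simp: path_edges_upt simp del: upt_Suc)
    also have "path_edges [Suc k..<Suc m] = {(i, Suc i) | i. k < i \<and> i < m}"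
      by (auto simp: path_edges_upt Suc_le_eq simp del: upt_Suc)
    finally show ?thesis by auto
  qed
  show "(k, Suc k) \<notin> path_edges ?p"
    unfolding pe using k by auto
  have "path_weight ?I [0..<Suc k] = 0" "path_weight ?I [Suc k..<Suc m] = 0"
    using k by (auto intro!: path_weight_eq_0 simp: path_edges_upt simp del: upt_Suc)
  moreover have "path_weight ?I ?p = path_weight ?I [0..<Suc k] + wt ?I (k, m + 1 + j)
      + path_weight ?I (?q @ [Suc k..<Suc m])"
    using ne by (subst path_weight_append) (auto simp del: upt_Suc gadget_sel)
  moreover have "path_weight ?I (?q @ [Suc k..<Suc m])
      = path_weight ?I ?q + wt ?I (3 * m + 1 + k, Suc k) + path_weight ?I [Suc k..<Suc m]"
    using ne by (subst path_weight_append) (auto simp del: upt_Suc gadget_sel)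
  ultimately show "path_weight ?I ?p = m"
    using k by (simp add: path_weight_Cons2 path_weight_single del: upt_Suc)
  show "simple_st_path ?I ?p"
    unfolding simple_st_path_def st_path_def is_path_def
  proof (intro conjI)
    show "path_edges ?p \<subseteq> E ?I"
      unfolding pe using k by (auto simp: gadget_E)
    show "hd ?p = src ?I" by (simp add: hd_append hd_upt del: upt_Suc)
    show "last ?p = tgt ?I" using k by simp
    show "set ?p \<subseteq> {..<nv ?I}" using n k by auto
    show "distinct ?p" using k by auto
  qed simp
qed

section \<open>Replacement and second-path weights of the gadget\<close>

lemma gadget_repl_weight_disjoint:
  assumes "k < m" "x \<inter> y = {}"
  shows "enat m < repl_weight (gadget n m x y) (k, Suc k)"
proof -
  \<comment> \<open>A strict bound need not survive an infimum, so integrality first turns it into a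
    weak one; an empty set of paths is covered as well.\<close>
  have "enat (Suc m) \<le> repl_weight (gadget n m x y) (k, Suc k)"
    unfolding repl_weight_def
  proof (rule Inf_greatest)
    fix w assume "w \<in> {enat (path_weight (gadget n m x y) p) |p.
      simple_st_path (gadget n m x y) p \<and> (k, Suc k) \<notin> path_edges p}"
    then obtain p where "w = enat (path_weight (gadget n m x y) p)"
      "st_path (gadget n m x y) p" "(k, Suc k) \<notin> path_edges p"
      by (auto simp: simple_st_path_def)
    then show "enat (Suc m) \<le> w" using gadget_disjoint_weight[OF assms] by (simp add: Suc_le_eq)
  qed
  then show ?thesis by (meson enat_ord_simps(2) lessI less_le_trans)
qed

lemma gadget_sisp_weight_disjoint:
  assumes "x \<inter> y = {}"
  shows "enat m < sisp_weight (gadget n m x y)"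
proof -
  have "enat (Suc m) \<le> sisp_weight (gadget n m x y)"
    unfolding sisp_weight_def gadget_path_edges
  proof (rule Inf_greatest)
    fix w assume "w \<in> {enat (path_weight (gadget n m x y) p) |p.
      simple_st_path (gadget n m x y) p \<and> \<not> {(k, Suc k) |k. k < m} \<subseteq> path_edges p}"
    then obtain p k where "w = enat (path_weight (gadget n m x y) p)"
      "st_path (gadget n m x y) p" "(k, Suc k) \<notin> path_edges p" "k < m"
      by (auto simp: simple_st_path_def)
    then show "enat (Suc m) \<le> w" using gadget_disjoint_weight assms by (simp add: Suc_le_eq)
  qed
  then show ?thesis by (meson enat_ord_simps(2) lessI less_le_trans)
qed

lemma gadget_weights_intersecting:
  assumes "4 * m + 2 \<le> n" "k < m" "j < m" "(k, j) \<in> x" "(k, j) \<in> y"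
  shows "repl_weight (gadget n m x y) (k, Suc k) \<le> enat m"
    and "sisp_weight (gadget n m x y) \<le> enat m"
proof -
  obtain p where p: "simple_st_path (gadget n m x y) p" "(k, Suc k) \<notin> path_edges p"
    "path_weight (gadget n m x y) p = m"
    using gadget_intersecting_path[OF assms] .
  show "repl_weight (gadget n m x y) (k, Suc k) \<le> enat m"
  proof -
    have "enat (path_weight (gadget n m x y) p) \<in> {enat (path_weight (gadget n m x y) p) |p.
        simple_st_path (gadget n m x y) p \<and> (k, Suc k) \<notin> path_edges p}"
      using p by blast
    then show ?thesis unfolding repl_weight_def p(3) by (rule Inf_lower)
  qed
  show "sisp_weight (gadget n m x y) \<le> enat m"
  proof -
    have "enat (path_weight (gadget n m x y) p) \<in> {enat (path_weight (gadget n m x y) p) |p.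
        simple_st_path (gadget n m x y) p \<and> \<not> {(k, Suc k) |k. k < m} \<subseteq> path_edges p}"
      using p assms(2) by blast
    then show ?thesis unfolding sisp_weight_def gadget_path_edges p(3) by (rule Inf_lower)
  qed
qed

section \<open>Round lower bounds from the gadget\<close>

lemma gadget_rounds_lower_bound:
  fixes R :: "'o dalg pmf"
  assumes n: "4 * m + 2 \<le> n" and bw: "bandwidth_ok R B" and sol: "solves C R n (n ^ 1) 2 T"
    and m: "70 \<le> m"
    and disj: "\<And>x y Out. x \<inter> y = {} \<Longrightarrow> C (gadget n m x y) Out \<Longrightarrow> \<forall>v<n. good (Out v)"
    and isect: "\<And>x y Out k j. k < m \<Longrightarrow> j < m \<Longrightarrow> (k, j) \<in> x \<Longrightarrow> (k, j) \<in> y \<Longrightarrow>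
        C (gadget n m x y) Out \<Longrightarrow> \<exists>v<n. \<not> good (Out v)"
  shows "real m \<le> 51200 * (real B + 1) * real T"
proof -
  define U where "U = {..<m} \<times> {..<m}"
  have cU: "card U = m\<^sup>2" by (simp add: U_def card_cartesian_product power2_eq_square)
  have "card U * exp (card U / 6400) \<le> 4800 * 2 ^ ((B + 1) * (T * card (gadget_cut m)))"
  proof (rule congest_cut_lower_bound[OF gadget_two_party_network[OF n] _ bw sol gadget_valid[OF n] disj])
    show "finite U" by (simp add: U_def)
    show "\<exists>v<n. \<not> good (Out v)"
      if xy: "x \<subseteq> U" "y \<subseteq> U" "x \<inter> y \<noteq> {}" and C: "C (gadget n m x y) Out" for x y Out
    proof -
      obtain k j where "(k, j) \<in> x" "(k, j) \<in> y" using xy(3) by auto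
      moreover from this have "k < m" "j < m" using xy(1) by (auto simp: U_def)
      ultimately show ?thesis using isect C by blast
    qed
  qed
  also have "\<dots> \<le> 4800 * 2 ^ ((B + 1) * (T * (8 * m)))"
    using card_gadget_cut[of m] by (intro mult_left_mono power_increasing) auto
  also have "\<dots> \<le> 4800 * exp (real ((B + 1) * (T * (8 * m))))"
  proof -
    have "(2::real) \<le> exp 1" using exp_ge_add_one_self[of 1] by simp
    then have "(2::real) ^ N \<le> exp 1 ^ N" for N by (intro power_mono) auto
    then have "(2::real) ^ N \<le> exp (real N)" for N by (simp add: exp_of_nat_mult[symmetric])
    from mult_left_mono[OF this, of 4800] show ?thesis by (simp only: zero_le_numeral simp_thms)
  qed
  finally have 1: "card U * exp (card U / 6400) \<le> 4800 * exp (real ((B + 1) * (T * (8 * m))))" .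
  \<comment> \<open>The reason for \<open>70 \<le> m\<close>: since \<open>70^2 = 4900\<close>, the
    factor \<open>card U\<close> absorbs the constant and only the exponents remain to be
    compared.\<close>
  have "4800 \<le> card U" unfolding cU using power_mono[OF m, of 2] by simp
  then have "4800 * exp (card U / 6400) \<le> card U * exp (card U / 6400)"
    by (intro mult_right_mono) auto
  with 1 have "exp (card U / 6400) \<le> exp (real ((B + 1) * (T * (8 * m))))" by linarith
  \<comment> \<open>Here \<open>51200 = 8 * 6400\<close>. One factor \<open>m\<close> cancels, as
    there are \<open>m^2\<close> elements but only \<open>8 * m\<close> cut pairs.\<close>
  then have "real m * real m \<le> real m * (51200 * (real B + 1) * real T)"
    by (simp add: cU power2_eq_square algebra_simps)
  then show ?thesis using m by (simp add: mult_le_cancel_left_pos)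
qed

text \<open>A test on one node's output, as the simulation demands. A node claiming no weight
  passes, so failure of the test needs an actual claim of at most \<open>m\<close>.\<close>

definition rp_good :: "nat \<Rightarrow> rp_out \<Rightarrow> bool" where
  "rp_good m r \<longleftrightarrow> (\<forall>k<m. \<forall>w. fst r (k, Suc k) = Some w \<longrightarrow> enat m < w)"

definition sisp_good :: "nat \<Rightarrow> sisp_out \<Rightarrow> bool" where
  "sisp_good m r \<longleftrightarrow> (\<forall>w. fst r = Some w \<longrightarrow> enat m < w)"

lemma RP_correct_claims:
  assumes "RP_correct I Out" and e: "e \<in> path_edges (P I)"
  shows "\<exists>v<nv I. fst (Out v) e = Some (repl_weight I e)"
    and "v < nv I \<Longrightarrow> fst (Out v) e = Some w \<Longrightarrow> w = repl_weight I e"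
proof -
  note c = bspec[OF assms(1)[unfolded RP_correct_def] e]
  note ex = conjunct1[OF c] and all = conjunct1[OF conjunct2[OF c]]
  from ex all show "\<exists>v<nv I. fst (Out v) e = Some (repl_weight I e)" by blast
  from all show "v < nv I \<Longrightarrow> fst (Out v) e = Some w \<Longrightarrow> w = repl_weight I e" by auto
qed

lemma SISP_correct_claims:
  assumes "SISP_correct I Out"
  shows "\<exists>v<nv I. fst (Out v) = Some (sisp_weight I)"
    and "v < nv I \<Longrightarrow> fst (Out v) = Some w \<Longrightarrow> w = sisp_weight I"
proof -
  note c = assms[unfolded SISP_correct_def]
  note ex = conjunct1[OF c] and all = conjunct1[OF conjunct2[OF c]]
  from ex all show "\<exists>v<nv I. fst (Out v) = Some (sisp_weight I)" by blast
  from all show "v < nv I \<Longrightarrow> fst (Out v) = Some w \<Longrightarrow> w = sisp_weight I" by auto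
qed

lemma rp_rounds_lower_bound:
  assumes "4 * m + 2 \<le> n" "bandwidth_ok R B" "solves RP_correct R n (n ^ 1) 2 T" "70 \<le> m"
  shows "real m \<le> 51200 * (real B + 1) * real T"
proof (rule gadget_rounds_lower_bound[OF assms, where good = "rp_good m"])
  fix x y Out
  assume xy: "x \<inter> y = {}" and C: "RP_correct (gadget n m x y) Out"
  show "\<forall>v<n. rp_good m (Out v)"
    unfolding rp_good_def
  proof (intro allI impI)
    fix v k w assume *: "v < n" "k < m" "fst (Out v) (k, Suc k) = Some w"
    then have "w = repl_weight (gadget n m x y) (k, Suc k)"
      by (intro RP_correct_claims(2)[OF C]) (auto simp: gadget_path_edges simp del: gadget_sel(4))
    then show "enat m < w"
      using gadget_repl_weight_disjoint[OF *(2) xy] by simp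
  qed
next
  fix x y Out k j
  assume k: "k < m" "j < m" "(k, j) \<in> x" "(k, j) \<in> y" and C: "RP_correct (gadget n m x y) Out"
  have "(k, Suc k) \<in> path_edges (P (gadget n m x y))"
    unfolding gadget_path_edges using k(1) by blast
  from RP_correct_claims(1)[OF C this]
  obtain v where "v < n" "fst (Out v) (k, Suc k) = Some (repl_weight (gadget n m x y) (k, Suc k))"
    by auto
  then show "\<exists>v<n. \<not> rp_good m (Out v)"
    using gadget_weights_intersecting(1)[OF assms(1) k] k(1) unfolding rp_good_def by (meson not_less)
qed

lemma sisp_rounds_lower_bound:
  assumes "4 * m + 2 \<le> n" "bandwidth_ok R B" "solves SISP_correct R n (n ^ 1) 2 T" "70 \<le> m"
  shows "real m \<le> 51200 * (real B + 1) * real T"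
proof (rule gadget_rounds_lower_bound[OF assms, where good = "sisp_good m"])
  fix x y Out
  assume xy: "x \<inter> y = {}" and C: "SISP_correct (gadget n m x y) Out"
  show "\<forall>v<n. sisp_good m (Out v)"
    unfolding sisp_good_def
  proof (intro allI impI)
    fix v w assume "v < n" "fst (Out v) = Some w"
    then have "w = sisp_weight (gadget n m x y)"
      by (intro SISP_correct_claims(2)[OF C]) auto
    then show "enat m < w"
      using gadget_sisp_weight_disjoint[OF xy] by simp
  qed
next
  fix x y Out k j
  assume k: "k < m" "j < m" "(k, j) \<in> x" "(k, j) \<in> y" and C: "SISP_correct (gadget n m x y) Out"
  from SISP_correct_claims(1)[OF C]
  obtain v where "v < n" "fst (Out v) = Some (sisp_weight (gadget n m x y))"
    by auto
  then show "\<exists>v<n. \<not> sisp_good m (Out v)"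
    using gadget_weights_intersecting(2)[OF assms(1) k] unfolding sisp_good_def by (meson not_less)
qed

text \<open>From \<open>n \<ge> 1000\<close>, \<open>n\<close> is at most 8 times the gadget size,
  and \<open>b * clog n + 1\<close> is at most \<open>2 * (b + 1)\<close> times the logarithm. With
  51200 this gives 819200, rounded up to 1024000.\<close>

lemma rounds_bound_arith:
  assumes n: "1000 \<le> n" and T: "real ((n - 2) div 4) \<le> 51200 * (real (b * clog n) + 1) * real T"
  shows "real T \<ge> 1 / (1024000 * (real b + 1)) * real n / log 2 (real n)"
proof -
  have "n \<le> 8 * ((n - 2) div 4)" using n by linarith
  then have m: "real n \<le> 8 * real ((n - 2) div 4)" by linarith
  have "log 2 (2 ^ 1) \<le> log 2 (real n)" using n by (subst log_le_cancel_iff) auto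
  then have l: "1 \<le> log 2 (real n)" by simp
  have "real (clog n) \<le> log 2 (real n) + 1" unfolding clog_def using l by linarith
  then have "real b * real (clog n) \<le> real b * (log 2 (real n) + 1)" by (intro mult_left_mono) auto
  also have "\<dots> \<le> real b * (2 * log 2 (real n))" using l by (intro mult_left_mono) auto
  finally have "real (b * clog n) + 1 \<le> 2 * (real b + 1) * log 2 (real n)"
    using l by (simp add: algebra_simps)
  then have "51200 * (real (b * clog n) + 1) * real T \<le> 51200 * (2 * (real b + 1) * log 2 (real n)) * real T"
    by (intro mult_right_mono mult_left_mono) auto
  then have "real n \<le> 819200 * ((real b + 1) * log 2 (real n) * real T)" using m T by linarith
  moreover have "0 \<le> (real b + 1) * log 2 (real n) * real T" using l by simp
  ultimately have "real n \<le> 1024000 * ((real b + 1) * log 2 (real n) * real T)" by linarith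
  then have "real n \<le> real T * log 2 (real n) * (1024000 * (real b + 1))"
    by (simp add: algebra_simps)
  then have "real n / (1024000 * (real b + 1)) \<le> real T * log 2 (real n)"
    by (subst pos_divide_le_eq) auto
  then have "real n / (1024000 * (real b + 1)) / log 2 (real n) \<le> real T"
    using l by (subst pos_divide_le_eq) auto
  then show ?thesis by simp
qed

text \<open>Diameter 2 and weight exponent 1 serve every bandwidth constant; only \<open>c\<close>
  varies with \<open>b\<close>.\<close>

theorem theorem1:
  shows "\<exists>(D0::nat) (k::nat). \<forall>b::nat. \<exists>c::real. c > 0 \<and> (\<exists>N0::nat. \<forall>n \<ge> N0. \<forall>T::nat.
     (\<forall>R :: rp_out dalg pmf. bandwidth_ok R (b * clog n) \<and> solves RP_correct R n (n ^ k) D0 T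
        \<longrightarrow> real T \<ge> c * real n / log 2 (real n)) \<and>
     (\<forall>R :: sisp_out dalg pmf. bandwidth_ok R (b * clog n) \<and> solves SISP_correct R n (n ^ k) D0 T
        \<longrightarrow> real T \<ge> c * real n / log 2 (real n)))"
proof (rule exI[of _ 2], rule exI[of _ 1], intro allI)
  fix b :: nat
  let ?c = "1 / (1024000 * (real b + 1))"
  have "?c > 0" by simp
  moreover have "\<forall>n\<ge>1000. \<forall>T.
     (\<forall>R :: rp_out dalg pmf. bandwidth_ok R (b * clog n) \<and> solves RP_correct R n (n ^ 1) 2 T
        \<longrightarrow> real T \<ge> ?c * real n / log 2 (real n)) \<and>
     (\<forall>R :: sisp_out dalg pmf. bandwidth_ok R (b * clog n) \<and> solves SISP_correct R n (n ^ 1) 2 T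
        \<longrightarrow> real T \<ge> ?c * real n / log 2 (real n))"
  proof (intro allI impI conjI; elim conjE)
    fix n T :: nat assume n: "1000 \<le> n"
    \<comment> \<open>The largest gadget fitting into \<open>n\<close> vertices; the remaining
      vertices are padding.\<close>
    have m: "4 * ((n - 2) div 4) + 2 \<le> n" "70 \<le> (n - 2) div 4" using n by linarith+
    show "real T \<ge> ?c * real n / log 2 (real n)"
      if "bandwidth_ok R (b * clog n)" "solves RP_correct R n (n ^ 1) 2 T" for R :: "rp_out dalg pmf"
      using rounds_bound_arith[OF n rp_rounds_lower_bound[OF m(1) that m(2)]] .
    show "real T \<ge> ?c * real n / log 2 (real n)"
      if "bandwidth_ok R (b * clog n)" "solves SISP_correct R n (n ^ 1) 2 T" for R :: "sisp_out dalg pmf"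
      using rounds_bound_arith[OF n sisp_rounds_lower_bound[OF m(1) that m(2)]] .
  qed
  ultimately show "\<exists>c::real. c > 0 \<and> (\<exists>N0::nat. \<forall>n \<ge> N0. \<forall>T::nat.
     (\<forall>R :: rp_out dalg pmf. bandwidth_ok R (b * clog n) \<and> solves RP_correct R n (n ^ 1) 2 T
        \<longrightarrow> real T \<ge> c * real n / log 2 (real n)) \<and>
     (\<forall>R :: sisp_out dalg pmf. bandwidth_ok R (b * clog n) \<and> solves SISP_correct R n (n ^ 1) 2 T
        \<longrightarrow> real T \<ge> c * real n / log 2 (real n)))" by blast
qed

end
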